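(* Let $A$, $B$, $T>0$ and the operators $W^T$, $W_\#^T$, $C^T$ be as in the context. Assume: (a) the spectrum of $A$, denoted $\{\lambda_k\}_{k=1}^\infty$, is not simple, and $L_k$ denotes the multiplicity of $\lambda_k$; (b) the set of root vectors $\{\varphi_k^l\}$, $k\in\mathbb N$, $1\le l\le L_k$, of $A$ forms a Riesz basis in $H$, with $(A-\lambda_kI)\varphi_k^1=0$ and $(A-\lambda_kI)\varphi_k^l=\varphi_k^{l-1}$ for $2\le l\le L_k$; (c) the spectrum of $A^*$ is $\{\overline{\lambda_k}\}_{k=1}^\infty$ and the root vectors $\{\psi_k^l\}$, $k\in\mathbb N$, $1\le l\le L_k$, of $A^*$ also form a Riesz basis in $H$, with $(A^*-\overline{\lambda_k}I)\psi_k^{L_k}=0$ and $(A^*-\overline{\lambda_k}I)\psi_k^l=\psi_k^{l+1}$ for $1\le l\le L_k-1$; (d) $(\varphi_k^l,\psi_r^s)_H=\delta_{kr}\delta_{ls}$; (e) both control systems of the context are spectrally controllable: there are controls in $H_0^1((0,T);Y)$ that $W^T$ maps to $\varphi_k^l$ and controls in $H_0^1((0,T);Y)$ that $W_\#^T$ maps to $\psi_k^l$, for all $k,l$. Let $\lambda$ be an eigenvalue and $f^{(1)},\dots,f^{(M)}$ a corresponding chain of functions solving the generalized spectral problem $$C^T\tfrac{d}{dt}f^{(1)}+i\lambda C^Tf^{(1)}=0,\qquad C^T\tfrac{d}{dt}f^{(j)}+i\lambda C^Tf^{(j)}=-iC^Tf^{(j-1)},\quad 2\le j\le M,$$ and write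 $W^Tf^{(1)}=\sum_{r=1}^\infty\sum_{l=1}^{L_r}a_r^l\varphi_r^l$ with $a_r^l\in\mathbb R$. Then $a_r^l=0$ for all $1\le l\le L_r$ whenever $\lambda\ne\lambda_r$, while for $k$ with $\lambda=\lambda_k$ one has $a_k^l=0$ for $2\le l\le L_k$ and $a_k^1=:\alpha_1$ is arbitrary; that is, $W^Tf^{(1)}=\alpha_1\varphi_k^1$, so $f^{(1)}$ is a (non-normalized) control driving the system to the state $\varphi_k^1$. Moreover, for $2\le j\le M$ and $k$ with $\lambda=\lambda_k$, $$W^Tf^{(j)}=\sum_{l=1}^{j}\alpha_{j-l+1}\,\varphi_k^l,$$ where at each step the coefficient $\alpha_j$ of $\varphi_k^1$ is arbitrary. Thus the solutions $\{f_k^l\}$, $k\in\mathbb N$, $1\le l\le L_k$, of the generalized spectral problem are controls to linear combinations of the root vectors associated to $\lambda_k$. Similarly, the generalized spectral problem associated to the adjoint system, $$(C^T)^*\tfrac{d}{dt}g_k^{L_k}-i\overline{\lambda_k}(C^T)^*g_k^{L_k}=0,\qquad (C^T)^*\tfrac{d}{dt}g_k^l-i\overline{\lambda_k}(C^T)^*g_k^l=i(C^T)^*g_k^{l+1},\quad 1\le l\le L_k-1,$$ yields controls $\{g_k^l\}$ such that $$W_\#^Tg_k^l=\sum_{j=1}^{L_k-l+1}\beta_j\,\psi_k^{j+l-1}.$$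
   Context: $H$ and $Y$ are Hilbert spaces, $A$ is an operator in $H$, not necessarily self-adjoint, with adjoint $A^*$, and $B:Y\to H$ is an input operator. $T>0$ is fixed and $\mathcal F^T=L^2((0,T);Y)$. For $f\in\mathcal F^T$, $u^f$ denotes the solution of $iu_t-Au=Bf$, $t>0$, $u(0)=0$; for $g\in\mathcal F^T$, $v^g$ denotes the solution of the adjoint system $iv_t+A^*v=-Bg$, $t>0$, $v(0)=0$. These are the two control systems. The control operators $W^T,W_\#^T:\mathcal F^T\to H$ are $W^Tf=u^f(T)$ and $W_\#^Tg=v^g(T)$. The connecting operator $C^T:\mathcal F^T\to\mathcal F^T$ is defined by $(C^Tf,g)_{\mathcal F^T}=(u^f(T),v^g(T))_H=(W^Tf,W_\#^Tg)_H$.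
   Formalization: The solutions f^(j) and g_k^l of the generalized spectral problems are required to lie in H_0^1((0,T);Y), the control space of (e); without these boundary conditions the claim fails, e.g. for f = e^{-iλt}φ with λ outside the spectrum. *)

theory Defs
  imports "HOL-Analysis.Analysis"
begin

section \<open>Complex Hilbert spaces\<close>

text \<open>The inner product is linear in its first argument.\<close>

class complex_hilbert = banach +
  fixes scaleC :: "complex \<Rightarrow> 'a \<Rightarrow> 'a"  (infixr "*\<^sub>C" 75)
    and cinner :: "'a \<Rightarrow> 'a \<Rightarrow> complex"
  assumes scaleC_add_right: "c *\<^sub>C (x + y) = c *\<^sub>C x + c *\<^sub>C y"
    and scaleC_add_left: "(c + d) *\<^sub>C x = c *\<^sub>C x + d *\<^sub>C x"
    and scaleC_scaleC: "c *\<^sub>C (d *\<^sub>C x) = (c * d) *\<^sub>C x"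
    and scaleC_of_real: "complex_of_real r *\<^sub>C x = r *\<^sub>R x"
    and cinner_add_left: "cinner (x + y) z = cinner x z + cinner y z"
    and cinner_scaleC_left: "cinner (c *\<^sub>C x) y = c * cinner x y"
    and cinner_commute: "cinner x y = cnj (cinner y x)"
    and cinner_self: "cinner x x = complex_of_real ((norm x)\<^sup>2)"

lemma vector_space_scaleC:
  "vector_space (scaleC :: complex \<Rightarrow> 'a \<Rightarrow> 'a::complex_hilbert)"
proof
  fix x :: 'a
  show "1 *\<^sub>C x = x"
    using scaleC_of_real[of 1 x] by simp
qed (simp_all add: scaleC_add_right scaleC_add_left scaleC_scaleC)

global_interpretation complex_vs: vector_space "scaleC :: complex \<Rightarrow> 'a \<Rightarrow> 'a::complex_hilbert"
  by (rule vector_space_scaleC)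

definition bounded_clinear :: "('a::complex_hilbert \<Rightarrow> 'b::complex_hilbert) \<Rightarrow> bool" where
  "bounded_clinear F \<longleftrightarrow> bounded_linear F \<and> (\<forall>c x. F (c *\<^sub>C x) = c *\<^sub>C F x)"

definition orthonormal_basis :: "'i set \<Rightarrow> ('i \<Rightarrow> 'a::complex_hilbert) \<Rightarrow> bool" where
  "orthonormal_basis I e \<longleftrightarrow>
     (\<forall>i\<in>I. \<forall>j\<in>I. cinner (e i) (e j) = of_bool (i = j)) \<and>
     closure (complex_vs.span (e ` I)) = UNIV"

definition riesz_basis :: "'i set \<Rightarrow> ('i \<Rightarrow> 'a::complex_hilbert) \<Rightarrow> bool" where
  "riesz_basis I b \<longleftrightarrow>
     (\<exists>(U :: 'a \<Rightarrow> 'a) e. orthonormal_basis I e \<and> bounded_clinear U \<and> bij U \<and>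
        bounded_clinear (inv U) \<and> (\<forall>i\<in>I. b i = U (e i)))"


section \<open>Unbounded operators\<close>

text \<open>An operator is given by its domain \<open>D\<close> and a function \<open>A\<close>; its values outside
  \<open>D\<close> are irrelevant.\<close>

definition densely_defined_operator :: "'a::complex_hilbert set \<Rightarrow> ('a \<Rightarrow> 'a) \<Rightarrow> bool" where
  "densely_defined_operator D A \<longleftrightarrow>
     complex_vs.subspace D \<and> closure D = UNIV \<and>
     (\<forall>x\<in>D. \<forall>y\<in>D. A (x + y) = A x + A y) \<and> (\<forall>c. \<forall>x\<in>D. A (c *\<^sub>C x) = c *\<^sub>C A x)"

definition adj_domain :: "'a::complex_hilbert set \<Rightarrow> ('a \<Rightarrow> 'a) \<Rightarrow> 'a set" where
  "adj_domain D A = {y. \<exists>z. \<forall>x\<in>D. cinner (A x) y = cinner x z}"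

definition adj :: "'a::complex_hilbert set \<Rightarrow> ('a \<Rightarrow> 'a) \<Rightarrow> 'a \<Rightarrow> 'a" where
  "adj D A y = (THE z. \<forall>x\<in>D. cinner (A x) y = cinner x z)"

definition op_resolvent_set :: "'a::complex_hilbert set \<Rightarrow> ('a \<Rightarrow> 'a) \<Rightarrow> complex set" where
  "op_resolvent_set D A =
     {z. \<exists>R. bounded_clinear R \<and>
           (\<forall>y. R y \<in> D \<and> A (R y) - z *\<^sub>C R y = y) \<and> (\<forall>x\<in>D. R (A x - z *\<^sub>C x) = x)}"

definition op_spectrum :: "'a::complex_hilbert set \<Rightarrow> ('a \<Rightarrow> 'a) \<Rightarrow> complex set" where
  "op_spectrum D A = - op_resolvent_set D A"

text \<open>\<open>root_space D A z n\<close> is the kernel of \<open>(A - z)^n\<close> on its natural domain.\<close>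

primrec root_space :: "'a::complex_hilbert set \<Rightarrow> ('a \<Rightarrow> 'a) \<Rightarrow> complex \<Rightarrow> nat \<Rightarrow> 'a set" where
  "root_space D A z 0 = {0}"
| "root_space D A z (Suc n) = {x \<in> D. A x - z *\<^sub>C x \<in> root_space D A z n}"

text \<open>For an infinite-dimensional root space this is 0, by the convention for \<open>dim\<close>.\<close>

definition alg_multiplicity :: "'a::complex_hilbert set \<Rightarrow> ('a \<Rightarrow> 'a) \<Rightarrow> complex \<Rightarrow> nat" where
  "alg_multiplicity D A z = complex_vs.dim (\<Union>n. root_space D A z n)"


section \<open>\<open>L\<^sup>2\<close> and \<open>H\<^sub>0\<^sup>1\<close> on \<open>(0,T)\<close> with values in a Hilbert space\<close>

text \<open>Elements of \<open>L\<^sup>2((0,T);Y)\<close> are represented by functions, and equality in the space is equality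
  almost everywhere. Measurability is strong (Bochner) measurability, since \<open>Y\<close> need not be
  separable.\<close>

definition L2_space :: "real \<Rightarrow> (real \<Rightarrow> 'a::complex_hilbert) set" where
  "L2_space T =
     {f. (\<exists>s. (\<forall>n::nat. simple_function (lebesgue_on {0<..<T}) (s n)) \<and>
            (AE t in lebesgue_on {0<..<T}. (\<lambda>n. s n t) \<longlonglongrightarrow> f t)) \<and>
         integrable (lebesgue_on {0<..<T}) (\<lambda>t. (norm (f t))\<^sup>2)}"

definition L2_inner :: "real \<Rightarrow> (real \<Rightarrow> 'a::complex_hilbert) \<Rightarrow> (real \<Rightarrow> 'a) \<Rightarrow> complex" where
  "L2_inner T f g = (LINT t|lebesgue_on {0<..<T}. cinner (f t) (g t))"

text \<open>\<open>f\<close> lies in \<open>H\<^sub>0\<^sup>1\<close> with derivative \<open>f'\<close> iff \<open>f'\<close> is in \<open>L\<^sup>2\<close> and the absolutely continuous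
  representative of \<open>f\<close> is the primitive of \<open>f'\<close> that vanishes at 0, and it also vanishes at \<open>T\<close>.\<close>

definition H10_derivative ::
  "real \<Rightarrow> (real \<Rightarrow> 'a::complex_hilbert) \<Rightarrow> (real \<Rightarrow> 'a) \<Rightarrow> bool" where
  "H10_derivative T f f' \<longleftrightarrow>
     f \<in> L2_space T \<and> f' \<in> L2_space T \<and>
     (AE t in lebesgue_on {0<..<T}. (f' has_integral f t) {0..t}) \<and>
     (f' has_integral 0) {0..T}"

definition H10_space :: "real \<Rightarrow> (real \<Rightarrow> 'a::complex_hilbert) set" where
  "H10_space T = {f. \<exists>f'. H10_derivative T f f'}"

text \<open>The derivative is unique only up to null sets; a representative is chosen.\<close>

definition ddt :: "real \<Rightarrow> (real \<Rightarrow> 'a::complex_hilbert) \<Rightarrow> real \<Rightarrow> 'a" where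
  "ddt T f = (SOME f'. H10_derivative T f f')"


section \<open>Control systems\<close>

text \<open>Weak solutions (in the sense of J. M. Ball) of \<open>i u\<^sub>t - A u = h\<close>, \<open>u(0) = 0\<close> on \<open>[0,T]\<close>: tested
  with \<open>y\<close> in the domain of the adjoint and integrated in time. For a source \<open>h\<close> in \<open>L\<^sup>2\<close> the solution
  need not take values in the domain of \<open>A\<close>.\<close>

definition weak_solution ::
  "real \<Rightarrow> 'h::complex_hilbert set \<Rightarrow> ('h \<Rightarrow> 'h) \<Rightarrow> (real \<Rightarrow> 'h) \<Rightarrow> (real \<Rightarrow> 'h) \<Rightarrow> bool" where
  "weak_solution T D A h u \<longleftrightarrow>
     continuous_on {0..T} u \<and> u 0 = 0 \<and>
     (\<forall>y\<in>adj_domain D A. \<forall>t\<in>{0..T}.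
        ((\<lambda>s. cinner (u s) (adj D A y) + cinner (h s) y) has_integral \<i> * cinner (u t) y) {0..t})"

text \<open>The system \<open>i u\<^sub>t - A u = B f\<close>, \<open>u(0) = 0\<close>, has one and only one solution for each \<open>f\<close> in
  \<open>L\<^sup>2((0,T);Y)\<close>.\<close>

definition well_posed ::
  "real \<Rightarrow> 'h::complex_hilbert set \<Rightarrow> ('h \<Rightarrow> 'h) \<Rightarrow> ('y::complex_hilbert \<Rightarrow> 'h) \<Rightarrow> bool" where
  "well_posed T D A B \<longleftrightarrow>
     (\<forall>f\<in>L2_space T.
        (\<exists>u. weak_solution T D A (\<lambda>t. B (f t)) u) \<and>
        (\<forall>u v. weak_solution T D A (\<lambda>t. B (f t)) u \<longrightarrow> weak_solution T D A (\<lambda>t. B (f t)) v \<longrightarrow>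
           (\<forall>t\<in>{0..T}. u t = v t)))"

definition control_operator ::
  "real \<Rightarrow> 'h::complex_hilbert set \<Rightarrow> ('h \<Rightarrow> 'h) \<Rightarrow> ('y::complex_hilbert \<Rightarrow> 'h) \<Rightarrow> (real \<Rightarrow> 'y) \<Rightarrow> 'h"
  where
  "control_operator T D A B f = (THE x. \<exists>u. weak_solution T D A (\<lambda>t. B (f t)) u \<and> u T = x)"

definition connecting_operator ::
  "real \<Rightarrow> ((real \<Rightarrow> 'y::complex_hilbert) \<Rightarrow> 'h::complex_hilbert) \<Rightarrow> ((real \<Rightarrow> 'y) \<Rightarrow> 'h) \<Rightarrow>
   ((real \<Rightarrow> 'y) \<Rightarrow> (real \<Rightarrow> 'y)) \<Rightarrow> bool" where
  "connecting_operator T W W' C \<longleftrightarrow>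
     (\<forall>f\<in>L2_space T. C f \<in> L2_space T) \<and>
     (\<forall>f\<in>L2_space T. \<forall>g\<in>L2_space T. L2_inner T (C f) g = cinner (W f) (W' g))"

definition L2_adjoint ::
  "real \<Rightarrow> ((real \<Rightarrow> 'y::complex_hilbert) \<Rightarrow> (real \<Rightarrow> 'y)) \<Rightarrow> ((real \<Rightarrow> 'y) \<Rightarrow> (real \<Rightarrow> 'y)) \<Rightarrow> bool" where
  "L2_adjoint T C C' \<longleftrightarrow>
     (\<forall>g\<in>L2_space T. C' g \<in> L2_space T) \<and>
     (\<forall>f\<in>L2_space T. \<forall>g\<in>L2_space T. L2_inner T (C f) g = L2_inner T f (C' g))"


section \<open>The generalized spectral problems\<close>

definition spectral_chain ::
  "real \<Rightarrow> ((real \<Rightarrow> 'y::complex_hilbert) \<Rightarrow> (real \<Rightarrow> 'y)) \<Rightarrow> complex \<Rightarrow> nat \<Rightarrow>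
   (nat \<Rightarrow> real \<Rightarrow> 'y) \<Rightarrow> bool" where
  "spectral_chain T C \<mu> M f \<longleftrightarrow>
     1 \<le> M \<and> (\<forall>j\<in>{1..M}. f j \<in> H10_space T) \<and>
     (AE t in lebesgue_on {0<..<T}. C (ddt T (f 1)) t + (\<i> * \<mu>) *\<^sub>C C (f 1) t = 0) \<and>
     (\<forall>j\<in>{2..M}. AE t in lebesgue_on {0<..<T}.
        C (ddt T (f j)) t + (\<i> * \<mu>) *\<^sub>C C (f j) t = - (\<i> *\<^sub>C C (f (j - 1)) t))"

text \<open>Here the chain starts at the index \<open>N\<close> and runs down to 1.\<close>

definition adjoint_spectral_chain ::
  "real \<Rightarrow> ((real \<Rightarrow> 'y::complex_hilbert) \<Rightarrow> (real \<Rightarrow> 'y)) \<Rightarrow> complex \<Rightarrow> nat \<Rightarrow>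
   (nat \<Rightarrow> real \<Rightarrow> 'y) \<Rightarrow> bool" where
  "adjoint_spectral_chain T C' \<mu> N g \<longleftrightarrow>
     1 \<le> N \<and> (\<forall>l\<in>{1..N}. g l \<in> H10_space T) \<and>
     (AE t in lebesgue_on {0<..<T}. C' (ddt T (g N)) t - (\<i> * cnj \<mu>) *\<^sub>C C' (g N) t = 0) \<and>
     (\<forall>l\<in>{1..<N}. AE t in lebesgue_on {0<..<T}.
        C' (ddt T (g l)) t - (\<i> * cnj \<mu>) *\<^sub>C C' (g l) t = \<i> *\<^sub>C C' (g (Suc l)) t)"

end

(* For f in H_0^1 the primitive of u^{f'} solves the system with source B f, so u^{f'} is the derivative
   of u^f, and f(T) = 0 turns the equation at t = T into i W f' = A W f, weakly. Spectral controllability makes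
   the range of W_# total, so C acts on controls as faithfully as W does. Hence the generalized spectral
   problem says exactly that W f^(1), ..., W f^(M) is a Jordan chain of A, tested against the root vectors
   psi_k^l: a recurrence for the coefficients of W f^(j) in the basis phi_k^l. Since (C^T)^* is the
   connecting operator with the two systems exchanged, the adjoint problem is the same statement with the order of
   each chain reversed. *)

theory Submission
  imports Defs
begin

section \<open>Complex Hilbert spaces\<close>

text \<open>\<open>W f\<close> is not known to lie in \<open>D\<close>, so the equation
  \<open>(A - \<mu>) x = y\<close> is met only through its pairings with \<open>\<psi> r s\<close>;
  totality turns pairings back into identities of vectors. The multiplicities enter as a boundary
  condition: at \<open>s = L r\<close> the adjoint chain stops, so the recurrence has right-hand
  side 0 there. Off the eigenvalue the factor \<open>\<mu> - ev r\<close> cancels, and descent from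
  this boundary kills every coefficient. At \<open>\<mu> = ev k\<close> the factor disappears and
  the recurrence becomes a diagonal shift in \<open>(j, s)\<close>, so all coefficients are
  determined by the pairings with \<open>\<psi> k 1\<close>: these are the \<alpha>. The chain
  length \<open>M\<close> is not bounded by \<open>L k\<close>. In a longer chain the boundary
  condition forces the first \<open>M - L k\<close> of the \<alpha> to be 0. This is exactly what
  the formula for \<open>W (f j)\<close> needs, since its sum may run past the last root vector,
  where \<open>\<phi> k l\<close> is an arbitrary vector.\<close>

lemma cinner_add_right: "cinner x (y + z) = cinner x y + cinner x (z :: 'a::complex_hilbert)"
  by (metis cinner_add_left cinner_commute complex_cnj_add)

lemma cinner_scaleC_right: "cinner x (c *\<^sub>C y) = cnj c * cinner x (y :: 'a::complex_hilbert)"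
  by (metis cinner_commute cinner_scaleC_left complex_cnj_mult)

lemma cinner_zero_left [simp]: "cinner 0 (y :: 'a::complex_hilbert) = 0"
  using cinner_add_left[of 0 0 y] by simp

lemma cinner_zero_right [simp]: "cinner x (0 :: 'a::complex_hilbert) = 0"
  using cinner_add_right[of x 0 0] by simp

lemma cinner_minus_left: "cinner (- x) (y :: 'a::complex_hilbert) = - cinner x y"
  using cinner_add_left[of "- x" x y] by (simp add: eq_neg_iff_add_eq_0)

lemma cinner_minus_right: "cinner x (- y :: 'a::complex_hilbert) = - cinner x y"
  using cinner_add_right[of x "- y" y] by (simp add: eq_neg_iff_add_eq_0)

lemma cinner_diff_left: "cinner (x - y) (z :: 'a::complex_hilbert) = cinner x z - cinner y z"
  using cinner_add_left[of x "- y" z] by (simp add: cinner_minus_left)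

lemma cinner_diff_right: "cinner x (y - z :: 'a::complex_hilbert) = cinner x y - cinner x z"
  using cinner_add_right[of x y "- z"] by (simp add: cinner_minus_right)

lemma cinner_sum_left: "cinner (\<Sum>i\<in>I. f i) (y :: 'a::complex_hilbert) = (\<Sum>i\<in>I. cinner (f i) y)"
  by (induction I rule: infinite_finite_induct) (auto simp: cinner_add_left)

lemma cinner_eq_0_self: "cinner x x = 0 \<longleftrightarrow> x = (0 :: 'a::complex_hilbert)"
  by (simp add: cinner_self)

lemma cnj_mult_self: "cnj c * c = (complex_of_real (cmod c))\<^sup>2" "c * cnj c = (complex_of_real (cmod c))\<^sup>2"
  by (metis complex_norm_square mult.commute of_real_power)+

lemma norm_scaleC: "norm (c *\<^sub>C x) = norm c * norm (x :: 'a::complex_hilbert)"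
proof -
  have "complex_of_real ((norm (c *\<^sub>C x))\<^sup>2) = complex_of_real ((norm c * norm x)\<^sup>2)"
    unfolding cinner_self[symmetric] cinner_scaleC_left cinner_scaleC_right
    by (simp add: cinner_self power_mult_distrib cnj_mult_self flip: mult.assoc)
  then have "(norm (c *\<^sub>C x))\<^sup>2 = (norm c * norm x)\<^sup>2"
    using of_real_eq_iff by blast
  then show ?thesis
    by (simp add: power2_eq_iff_nonneg)
qed

lemma norm_cinner_le: "norm (cinner x y) \<le> norm x * norm (y :: 'a::complex_hilbert)"
proof (cases "y = 0")
  case False
  \<comment> \<open>The coefficient of the orthogonal projection of \<open>x\<close> onto the line
    of \<open>y\<close>. The residual is orthogonal to \<open>y\<close>, so its squared norm is its
    pairing with \<open>x\<close>; that this is nonnegative is the inequality.\<close>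
  define c where "c = cinner x y / complex_of_real ((norm y)\<^sup>2)"
  have n: "complex_of_real ((norm y)\<^sup>2) \<noteq> 0"
    using False by simp
  have "complex_of_real ((norm (x - c *\<^sub>C y))\<^sup>2) = cinner (x - c *\<^sub>C y) x"
    unfolding cinner_self[symmetric]
    using n by (simp add: cinner_diff_right cinner_scaleC_right cinner_diff_left cinner_scaleC_left
        cinner_self[of y] c_def)
  also have "\<dots> = complex_of_real ((norm x)\<^sup>2 - (norm (cinner x y))\<^sup>2 / (norm y)\<^sup>2)"
    by (simp add: cinner_diff_left cinner_scaleC_left cinner_self c_def cnj_mult_self
        cinner_commute[of y x])
  finally have "(norm (x - c *\<^sub>C y))\<^sup>2 = (norm x)\<^sup>2 - (norm (cinner x y))\<^sup>2 / (norm y)\<^sup>2"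
    using of_real_eq_iff by blast
  then have "(norm (cinner x y))\<^sup>2 / (norm y)\<^sup>2 \<le> (norm x)\<^sup>2"
    by (smt (verit) zero_le_power2)
  then have "(norm (cinner x y))\<^sup>2 \<le> (norm x * norm y)\<^sup>2"
    using False by (simp add: divide_le_eq power_mult_distrib)
  then show ?thesis
    by (rule power2_le_imp_le) simp
qed simp

lemma bounded_linear_cinner_left: "bounded_linear (\<lambda>x. cinner x (y :: 'a::complex_hilbert))"
proof (rule bounded_linear_intro)
  show "cinner (r *\<^sub>R x) y = r *\<^sub>R cinner x y" for r and x :: 'a
    by (simp add: cinner_scaleC_left scaleR_conv_of_real flip: scaleC_of_real)
qed (use norm_cinner_le in \<open>auto simp: cinner_add_left\<close>)

lemma bounded_linear_cinner_right: "bounded_linear (\<lambda>y. cinner (x :: 'a::complex_hilbert) y)"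
proof (rule bounded_linear_intro)
  show "cinner x (r *\<^sub>R y) = r *\<^sub>R cinner x y" for r and y :: 'a
    by (simp add: cinner_scaleC_right scaleR_conv_of_real flip: scaleC_of_real)
  show "norm (cinner x y) \<le> norm y * norm x" for y
    using norm_cinner_le[of x y] by (simp add: mult.commute)
qed (auto simp: cinner_add_right)

lemma bounded_linear_scaleC_right: "bounded_linear (\<lambda>x :: 'a::complex_hilbert. c *\<^sub>C x)"
proof (rule bounded_linear_intro)
  show "c *\<^sub>C (r *\<^sub>R x) = r *\<^sub>R (c *\<^sub>C x)" for r and x :: 'a
    by (simp add: mult.commute scaleC_scaleC flip: scaleC_of_real)
qed (auto simp: scaleC_add_right norm_scaleC mult.commute[of "norm c"])

lemma bounded_clinear_uminus:
  assumes "bounded_clinear B"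
  shows "bounded_clinear (\<lambda>y. - B y)"
  using assms unfolding bounded_clinear_def
  by (simp add: bounded_linear_minus complex_vs.scale_minus_right)

text \<open>The \<open>z\<close> with \<open>U z\<close> orthogonal to \<open>x\<close> form a
  closed subspace containing the orthonormal basis, hence the whole space; a \<open>z\<close> with
  \<open>U z = x\<close> then makes \<open>x\<close> orthogonal to itself. This is the form in which
  the Riesz bases enter the argument.\<close>

lemma riesz_basis_total:
  fixes x :: "'a::complex_hilbert"
  assumes "riesz_basis I b" and ortho: "\<And>i. i \<in> I \<Longrightarrow> cinner x (b i) = 0"
  shows "x = 0"
proof -
  obtain U :: "'a \<Rightarrow> 'a" and e where e: "orthonormal_basis I e" and U: "bounded_clinear U" "bij U"
    and b: "\<And>i. i \<in> I \<Longrightarrow> b i = U (e i)"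
    using assms(1) unfolding riesz_basis_def by blast
  have lin: "bounded_linear U" and scale: "U (c *\<^sub>C z) = c *\<^sub>C U z" for c z
    using U(1) unfolding bounded_clinear_def by auto
  define N where "N = {z. cinner x (U z) = 0}"
  have "complex_vs.span (e ` I) \<subseteq> N"
  proof (rule complex_vs.span_minimal)
    show "e ` I \<subseteq> N"
      using b ortho by (force simp: N_def)
    show "complex_vs.subspace N"
      unfolding complex_vs.subspace_def N_def
      by (simp add: linear_0 linear_add bounded_linear.linear[OF lin] cinner_add_right scale
          cinner_scaleC_right)
  qed
  moreover have "closed N"
    unfolding N_def
    by (intro closed_Collect_eq linear_continuous_on
        bounded_linear_compose[OF bounded_linear_cinner_right lin] continuous_on_const)
  ultimately have "closure (complex_vs.span (e ` I)) \<subseteq> N"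
    by (rule closure_minimal)
  then have "N = UNIV"
    using e unfolding orthonormal_basis_def by auto
  moreover obtain z where "U z = x"
    using U(2) by (metis bij_pointE)
  ultimately show ?thesis
    unfolding N_def using cinner_eq_0_self by auto
qed

section \<open>\<open>L\<^sup>2\<close> and \<open>H\<^sub>0\<^sup>1\<close>\<close>

text \<open>Members of \<open>L2_space\<close> are limits of simple functions only almost
  everywhere, so measurability has to survive changes on null sets.\<close>

lemma complete_measure_lebesgue_on:
  assumes "S \<in> sets lebesgue"
  shows "complete_measure (lebesgue_on S)"
proof
  fix A B assume AB: "A \<subseteq> B" "B \<in> null_sets (lebesgue_on S)"
  then have "A \<subseteq> S" "A \<in> null_sets lebesgue"
    using assms completion.complete2[of A B lborel] by (auto simp: null_sets_restrict_space)
  then show "A \<in> sets (lebesgue_on S)"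
    using assms by (auto simp: sets_restrict_space_iff)
qed

text \<open>\<open>f\<close> agrees almost everywhere with the measurable pointwise
  \<open>lim\<close>, so their preimages differ within a null set, which completeness makes
  harmless.\<close>

lemma (in complete_measure) borel_measurable_AE_lim:
  fixes f :: "'a \<Rightarrow> 'b::{banach, second_countable_topology}"
  assumes s: "\<And>n. s n \<in> borel_measurable M" and lim: "AE t in M. (\<lambda>n. s n t) \<longlonglongrightarrow> f t"
  shows "f \<in> borel_measurable M"
proof (rule borel_measurableI)
  fix S :: "'b set" assume "open S"
  define g where "g t = lim (\<lambda>n. s n t)" for t
  have g: "g \<in> borel_measurable M"
    unfolding g_def using s by (rule borel_measurable_lim_metric)
  show "f -` S \<inter> space M \<in> sets M"
  proof (rule in_sets_AE)
    show "g -` S \<inter> space M \<in> sets M"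
      using g \<open>open S\<close> by (auto intro: measurable_sets)
    show "AE x in M. x \<in> g -` S \<inter> space M \<longleftrightarrow> x \<in> f -` S \<inter> space M"
      using lim by eventually_elim (auto simp: g_def dest: limI)
  qed auto
qed

text \<open>As \<open>Y\<close> may be non-separable, continuity of \<open>h\<close> on the product
  cannot simply be composed with measurability of \<open>f\<close> and \<open>g\<close>. The
  approximants avoid this: \<open>h\<close> of two simple functions is simple, and only the limit,
  in a second countable space, has to be measurable.\<close>

lemma L2_space_borel_measurable:
  fixes h :: "'a::complex_hilbert \<Rightarrow> 'b::complex_hilbert \<Rightarrow> 'c::{banach, second_countable_topology}"
  assumes f: "f \<in> L2_space T" and g: "g \<in> L2_space T"
    and h: "\<And>a b x y. a \<longlonglongrightarrow> x \<Longrightarrow> b \<longlonglongrightarrow> y \<Longrightarrow> (\<lambda>n. h (a n) (b n)) \<longlonglongrightarrow> h x y"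
  shows "(\<lambda>t. h (f t) (g t)) \<in> borel_measurable (lebesgue_on {0<..<T})"
proof -
  let ?M = "lebesgue_on {0<..<T}"
  obtain p where p: "\<And>n::nat. simple_function ?M (p n)" "AE t in ?M. (\<lambda>n. p n t) \<longlonglongrightarrow> f t"
    using f unfolding L2_space_def by blast
  obtain q where q: "\<And>n::nat. simple_function ?M (q n)" "AE t in ?M. (\<lambda>n. q n t) \<longlonglongrightarrow> g t"
    using g unfolding L2_space_def by blast
  interpret complete_measure ?M
    by (rule complete_measure_lebesgue_on) simp
  show ?thesis
  proof (rule borel_measurable_AE_lim)
    show "(\<lambda>t. h (p n t) (q n t)) \<in> borel_measurable ?M" for n
      using p(1) q(1) by (blast intro: borel_measurable_simple_function simple_function_compose2[of _ "p n" "q n" h])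
    show "AE t in ?M. (\<lambda>n. h (p n t) (q n t)) \<longlonglongrightarrow> h (f t) (g t)"
      using p(2) q(2) by eventually_elim (rule h)
  qed
qed

lemma L2_space_norm_integrable:
  assumes "f \<in> L2_space T"
  shows "integrable (lebesgue_on {0<..<T}) (\<lambda>t. (norm (f t))\<^sup>2)"
  using assms by (simp add: L2_space_def)

lemma L2_space_scaleC:
  assumes f: "f \<in> L2_space T"
  shows "(\<lambda>t. c *\<^sub>C f t) \<in> L2_space T"
proof -
  let ?M = "lebesgue_on {0<..<T}"
  obtain p where p: "\<And>n::nat. simple_function ?M (p n)" "AE t in ?M. (\<lambda>n. p n t) \<longlonglongrightarrow> f t"
    using f unfolding L2_space_def by blast
  have "AE t in ?M. (\<lambda>n. c *\<^sub>C p n t) \<longlonglongrightarrow> c *\<^sub>C f t"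
    using p(2) by eventually_elim (rule bounded_linear.tendsto[OF bounded_linear_scaleC_right])
  moreover have "simple_function ?M (\<lambda>t. c *\<^sub>C p n t)" for n
    using p(1) by (rule simple_function_compose1)
  moreover have "integrable ?M (\<lambda>t. (norm (c *\<^sub>C f t))\<^sup>2)"
    using L2_space_norm_integrable[OF f] by (simp add: norm_scaleC power_mult_distrib)
  ultimately show ?thesis
    unfolding L2_space_def by (intro CollectI conjI exI[of _ "\<lambda>n t. c *\<^sub>C p n t"]) auto
qed

lemma L2_space_add:
  assumes f: "f \<in> L2_space T" and g: "g \<in> L2_space T"
  shows "(\<lambda>t. f t + g t) \<in> L2_space T"
proof -
  let ?M = "lebesgue_on {0<..<T}"
  obtain p where p: "\<And>n::nat. simple_function ?M (p n)" "AE t in ?M. (\<lambda>n. p n t) \<longlonglongrightarrow> f t"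
    using f unfolding L2_space_def by blast
  obtain q where q: "\<And>n::nat. simple_function ?M (q n)" "AE t in ?M. (\<lambda>n. q n t) \<longlonglongrightarrow> g t"
    using g unfolding L2_space_def by blast
  have lim: "AE t in ?M. (\<lambda>n. p n t + q n t) \<longlonglongrightarrow> f t + g t"
    using p(2) q(2) by eventually_elim (rule tendsto_add)
  have simple: "simple_function ?M (\<lambda>t. p n t + q n t)" for n
    using p(1) q(1) by (rule simple_function_compose2[of _ "p n" "q n" "(+)"])
  have int: "integrable ?M (\<lambda>t. (norm (f t + g t))\<^sup>2)"
  proof (rule Bochner_Integration.integrable_bound)
    show "integrable ?M (\<lambda>t. 2 * ((norm (f t))\<^sup>2 + (norm (g t))\<^sup>2))"
      using f g by (simp add: L2_space_norm_integrable)
    show "(\<lambda>t. (norm (f t + g t))\<^sup>2) \<in> borel_measurable ?M"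
      by (rule L2_space_borel_measurable[OF f g]) (intro tendsto_intros)
    show "AE t in ?M. norm ((norm (f t + g t))\<^sup>2) \<le> norm (2 * ((norm (f t))\<^sup>2 + (norm (g t))\<^sup>2))"
    proof (rule AE_I2)
      fix t
      have "(norm (f t + g t))\<^sup>2 \<le> (norm (f t) + norm (g t))\<^sup>2"
        by (simp add: norm_triangle_ineq power_mono)
      also have "\<dots> \<le> 2 * ((norm (f t))\<^sup>2 + (norm (g t))\<^sup>2)"
        using sum_squares_bound[of "norm (f t)" "norm (g t)"] by (simp add: power2_sum)
      finally show "norm ((norm (f t + g t))\<^sup>2) \<le> norm (2 * ((norm (f t))\<^sup>2 + (norm (g t))\<^sup>2))"
        by simp
    qed
  qed
  show ?thesis
    using lim simple int unfolding L2_space_def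
    by (intro CollectI conjI exI[of _ "\<lambda>n t. p n t + q n t"]) auto
qed

lemma L2_inner_integrable:
  assumes f: "f \<in> L2_space T" and g: "g \<in> L2_space T"
  shows "integrable (lebesgue_on {0<..<T}) (\<lambda>t. cinner (f t) (g t))"
proof (rule Bochner_Integration.integrable_bound)
  let ?M = "lebesgue_on {0<..<T}"
  show "integrable ?M (\<lambda>t. (norm (f t))\<^sup>2 + (norm (g t))\<^sup>2)"
    using f g by (simp add: L2_space_norm_integrable)
  have bilin: "bounded_bilinear (cinner :: 'a \<Rightarrow> 'a \<Rightarrow> complex)"
  proof
    show "\<exists>K. \<forall>a b :: 'a. norm (cinner a b) \<le> norm a * norm b * K"
      using norm_cinner_le by (intro exI[of _ 1]) auto
  qed (fact cinner_add_left cinner_add_right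
      linear_scale[OF bounded_linear.linear[OF bounded_linear_cinner_left]]
      linear_scale[OF bounded_linear.linear[OF bounded_linear_cinner_right]])+
  show "(\<lambda>t. cinner (f t) (g t)) \<in> borel_measurable ?M"
    by (rule L2_space_borel_measurable[OF f g], rule bounded_bilinear.tendsto[OF bilin])
  show "AE t in ?M. norm (cinner (f t) (g t)) \<le> norm ((norm (f t))\<^sup>2 + (norm (g t))\<^sup>2)"
  proof (rule AE_I2)
    fix t
    have "norm (cinner (f t) (g t)) \<le> norm (f t) * norm (g t)"
      by (rule norm_cinner_le)
    also have "\<dots> \<le> (norm (f t))\<^sup>2 + (norm (g t))\<^sup>2"
      using sum_squares_bound[of "norm (f t)" "norm (g t)"]
        mult_nonneg_nonneg[OF norm_ge_zero[of "f t"] norm_ge_zero[of "g t"]] by linarith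
    finally show "norm (cinner (f t) (g t)) \<le> norm ((norm (f t))\<^sup>2 + (norm (g t))\<^sup>2)"
      by simp
  qed
qed

lemma L2_inner_add_left:
  assumes "f \<in> L2_space T" "g \<in> L2_space T" "h \<in> L2_space T"
  shows "L2_inner T (\<lambda>t. f t + g t) h = L2_inner T f h + L2_inner T g h"
  unfolding L2_inner_def cinner_add_left
  by (rule Bochner_Integration.integral_add[OF L2_inner_integrable L2_inner_integrable])
    (use assms in auto)

lemma L2_inner_scaleC_left: "L2_inner T (\<lambda>t. c *\<^sub>C f t) g = c * L2_inner T f g"
  unfolding L2_inner_def cinner_scaleC_left by simp

lemma L2_inner_AE_zero_left:
  assumes "AE t in lebesgue_on {0<..<T}. f t = 0"
  shows "L2_inner T f g = 0"
  unfolding L2_inner_def by (rule integral_eq_zero_AE) (use assms in auto)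

lemma L2_inner_commute: "L2_inner T f g = cnj (L2_inner T g f)"
proof -
  have "L2_inner T f g = (LINT t|lebesgue_on {0<..<T}. cnj (cinner (g t) (f t)))"
    unfolding L2_inner_def by (rule Bochner_Integration.integral_cong[OF refl]) (rule cinner_commute)
  also have "\<dots> = cnj (L2_inner T g f)"
    unfolding L2_inner_def by (rule Bochner_Integration.integral_cnj)
  finally show ?thesis .
qed

lemma L2_inner_self_eq_0:
  assumes f: "f \<in> L2_space T" and 0: "L2_inner T f f = 0"
  shows "AE t in lebesgue_on {0<..<T}. f t = 0"
proof -
  have "integral\<^sup>L (lebesgue_on {0<..<T}) (\<lambda>t. (norm (f t))\<^sup>2) = 0"
    using 0 unfolding L2_inner_def cinner_self integral_complex_of_real by simp
  then have "AE t in lebesgue_on {0<..<T}. (norm (f t))\<^sup>2 = 0"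
    using integral_nonneg_eq_0_iff_AE[OF L2_space_norm_integrable[OF f]] by simp
  then show ?thesis
    by simp
qed

section \<open>Derivatives in \<open>H_0^1\<close> and its closure under linear combinations\<close>

lemma H10_derivativeD:
  assumes "H10_derivative T f f'"
  shows "f \<in> L2_space T" and "f' \<in> L2_space T"
    and "AE t in lebesgue_on {0<..<T}. (f' has_integral f t) {0..t}"
    and "(f' has_integral 0) {0..T}"
  using assms by (simp_all add: H10_derivative_def)

lemma H10_derivative_ddt: "f \<in> H10_space T \<Longrightarrow> H10_derivative T f (ddt T f)"
  using someI_ex[of "H10_derivative T f"] unfolding H10_space_def ddt_def by simp

lemma H10_spaceI: "H10_derivative T f f' \<Longrightarrow> f \<in> H10_space T"
  unfolding H10_space_def by auto

lemma H10_space_L2_space: "f \<in> H10_space T \<Longrightarrow> f \<in> L2_space T" "f \<in> H10_space T \<Longrightarrow> ddt T f \<in> L2_space T"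
  using H10_derivativeD(1,2)[OF H10_derivative_ddt] by blast+

text \<open>Only membership is claimed: \<open>ddt\<close> chooses a representative, so
  \<open>ddt T\<close> of a sum need not be the pointwise sum of the chosen derivatives.\<close>

lemma H10_space_add:
  assumes "f \<in> H10_space T" "g \<in> H10_space T"
  shows "(\<lambda>t. f t + g t) \<in> H10_space T"
proof (rule H10_spaceI)
  have f': "H10_derivative T f (ddt T f)" and g': "H10_derivative T g (ddt T g)"
    using assms by (simp_all add: H10_derivative_ddt)
  have "AE t in lebesgue_on {0<..<T}. (ddt T f has_integral f t) {0..t}"
    "AE t in lebesgue_on {0<..<T}. (ddt T g has_integral g t) {0..t}"
    by (rule H10_derivativeD(3)[OF f'], rule H10_derivativeD(3)[OF g'])
  then have "AE t in lebesgue_on {0<..<T}. ((\<lambda>s. ddt T f s + ddt T g s) has_integral f t + g t) {0..t}"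
    by eventually_elim (rule has_integral_add)
  moreover have "((\<lambda>s. ddt T f s + ddt T g s) has_integral 0) {0..T}"
    using has_integral_add[OF H10_derivativeD(4)[OF f'] H10_derivativeD(4)[OF g']] by simp
  ultimately show "H10_derivative T (\<lambda>t. f t + g t) (\<lambda>t. ddt T f t + ddt T g t)"
    unfolding H10_derivative_def using assms
    by (intro conjI L2_space_add H10_space_L2_space)
qed

lemma H10_space_scaleC:
  assumes "f \<in> H10_space T"
  shows "(\<lambda>t. c *\<^sub>C f t) \<in> H10_space T"
proof (rule H10_spaceI)
  have f': "H10_derivative T f (ddt T f)"
    using assms by (simp add: H10_derivative_ddt)
  have scale: "((\<lambda>t. c *\<^sub>C ddt T f t) has_integral c *\<^sub>C x) S" if "(ddt T f has_integral x) S" for x S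
    using has_integral_linear[OF that bounded_linear_scaleC_right] by (simp add: o_def)
  have "AE t in lebesgue_on {0<..<T}. (ddt T f has_integral f t) {0..t}"
    by (rule H10_derivativeD(3)[OF f'])
  then have "AE t in lebesgue_on {0<..<T}. ((\<lambda>s. c *\<^sub>C ddt T f s) has_integral c *\<^sub>C f t) {0..t}"
    by eventually_elim (rule scale)
  moreover have "((\<lambda>t. c *\<^sub>C ddt T f t) has_integral 0) {0..T}"
    using scale[OF H10_derivativeD(4)[OF f']] by simp
  ultimately show "H10_derivative T (\<lambda>t. c *\<^sub>C f t) (\<lambda>t. c *\<^sub>C ddt T f t)"
    unfolding H10_derivative_def using assms
    by (intro conjI L2_space_scaleC H10_space_L2_space)
qed

section \<open>Control operators\<close>

lemma control_operator_eq:
  assumes "T > 0" and "well_posed T D A B" and "f \<in> L2_space T"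
    and u: "weak_solution T D A (\<lambda>t. B (f t)) u"
  shows "control_operator T D A B f = u T"
  unfolding control_operator_def
proof (rule the_equality)
  show "\<exists>v. weak_solution T D A (\<lambda>t. B (f t)) v \<and> v T = u T"
    using u by blast
  fix x assume "\<exists>v. weak_solution T D A (\<lambda>t. B (f t)) v \<and> v T = x"
  moreover have "T \<in> {0..T}"
    using \<open>T > 0\<close> by simp
  ultimately show "x = u T"
    using assms unfolding well_posed_def by blast
qed

lemma weak_solution_add:
  assumes "weak_solution T D A h u" and "weak_solution T D A k v"
  shows "weak_solution T D A (\<lambda>t. h t + k t) (\<lambda>t. u t + v t)"
  unfolding weak_solution_def
proof (intro conjI ballI)
  fix y t assume "y \<in> adj_domain D A" and "t \<in> {0..T}"
  then have "((\<lambda>s. cinner (u s) (adj D A y) + cinner (h s) y) has_integral \<i> * cinner (u t) y) {0..t}"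
    and "((\<lambda>s. cinner (v s) (adj D A y) + cinner (k s) y) has_integral \<i> * cinner (v t) y) {0..t}"
    using assms unfolding weak_solution_def by blast+
  from has_integral_add[OF this]
  show "((\<lambda>s. cinner (u s + v s) (adj D A y) + cinner (h s + k s) y) has_integral
      \<i> * cinner (u t + v t) y) {0..t}"
    by (simp add: cinner_add_left algebra_simps)
qed (use assms in \<open>auto simp: weak_solution_def intro: continuous_on_add\<close>)

lemma weak_solution_scaleC:
  assumes "weak_solution T D A h u"
  shows "weak_solution T D A (\<lambda>t. c *\<^sub>C h t) (\<lambda>t. c *\<^sub>C u t)"
  unfolding weak_solution_def
proof (intro conjI ballI)
  have "continuous_on {0..T} u"
    using assms by (simp add: weak_solution_def)
  then show "continuous_on {0..T} (\<lambda>t. c *\<^sub>C u t)"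
    by (rule bounded_linear.continuous_on[OF bounded_linear_scaleC_right])
  show "c *\<^sub>C u 0 = 0"
    using assms by (simp add: weak_solution_def)
  fix y t assume "y \<in> adj_domain D A" and "t \<in> {0..T}"
  then have "((\<lambda>s. cinner (u s) (adj D A y) + cinner (h s) y) has_integral \<i> * cinner (u t) y) {0..t}"
    using assms unfolding weak_solution_def by blast
  from has_integral_mult_right[OF this, of c]
  show "((\<lambda>s. cinner (c *\<^sub>C u s) (adj D A y) + cinner (c *\<^sub>C h s) y) has_integral
      \<i> * cinner (c *\<^sub>C u t) y) {0..t}"
    by (simp add: cinner_scaleC_left algebra_simps)
qed

lemma well_posed_solution:
  assumes "well_posed T D A B" and "f \<in> L2_space T"
  obtains u where "weak_solution T D A (\<lambda>t. B (f t)) u"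
  using assms unfolding well_posed_def by blast

lemma control_operator_add:
  assumes T: "T > 0" and wp: "well_posed T D A B" and B: "bounded_clinear B"
    and f: "f \<in> L2_space T" and g: "g \<in> L2_space T"
  shows "control_operator T D A B (\<lambda>t. f t + g t) = control_operator T D A B f + control_operator T D A B g"
proof -
  obtain u where u: "weak_solution T D A (\<lambda>t. B (f t)) u"
    using well_posed_solution[OF wp f] .
  obtain v where v: "weak_solution T D A (\<lambda>t. B (g t)) v"
    using well_posed_solution[OF wp g] .
  have "B (x + y) = B x + B y" for x y
    using B by (simp add: bounded_clinear_def linear_add bounded_linear.linear)
  then have "weak_solution T D A (\<lambda>t. B (f t + g t)) (\<lambda>t. u t + v t)"
    using weak_solution_add[OF u v] by simp
  from control_operator_eq[OF T wp L2_space_add[OF f g] this] show ?thesis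
    using control_operator_eq[OF T wp f u] control_operator_eq[OF T wp g v] by simp
qed

lemma control_operator_scaleC:
  assumes T: "T > 0" and wp: "well_posed T D A B" and B: "bounded_clinear B"
    and f: "f \<in> L2_space T"
  shows "control_operator T D A B (\<lambda>t. c *\<^sub>C f t) = c *\<^sub>C control_operator T D A B f"
proof -
  obtain u where u: "weak_solution T D A (\<lambda>t. B (f t)) u"
    using well_posed_solution[OF wp f] .
  have "weak_solution T D A (\<lambda>t. B (c *\<^sub>C f t)) (\<lambda>t. c *\<^sub>C u t)"
    using weak_solution_scaleC[OF u] B by (simp add: bounded_clinear_def)
  from control_operator_eq[OF T wp L2_space_scaleC[OF f] this] show ?thesis
    using control_operator_eq[OF T wp f u] by simp
qed

text \<open>Bridge from almost-everywhere statements to the gauge integrals in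
  \<open>weak_solution\<close>, whose exceptional sets are \<open>negligible\<close>.\<close>

lemma AE_lebesgue_on_negligible:
  assumes "AE t in lebesgue_on {0<..<T}. P t"
  obtains N where "negligible N" and "\<And>t. t \<in> {0..T::real} - N \<Longrightarrow> P t"
proof -
  obtain N where N: "N \<in> null_sets (lebesgue_on {0<..<T})" "{t \<in> {0<..<T}. \<not> P t} \<subseteq> N"
    using assms unfolding eventually_ae_filter by auto
  have "negligible N"
    using N(1) by (simp add: null_sets_restrict_space negligible_iff_null_sets)
  \<comment> \<open>The measure on the open interval says nothing about 0 and \<open>T\<close>, so
    both endpoints join the exceptional set.\<close>
  then have "negligible (N \<union> {0, T})"
    by simp
  moreover have "P t" if "t \<in> {0..T} - (N \<union> {0, T})" for t
  proof -
    have "t \<in> {0<..<T}" and "t \<notin> N"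
      using that by auto
    then show ?thesis
      using N(2) by blast
  qed
  ultimately show ?thesis
    by (rule that)
qed

text \<open>The primitive of the solution for the source \<open>B f'\<close> solves the system with source \<open>B f\<close>,
  and \<open>f\<close> vanishes at \<open>T\<close>.\<close>

lemma control_operator_derivative:
  assumes T: "T > 0" and wp: "well_posed T D A B" and B: "bounded_clinear B"
    and f: "H10_derivative T f f'" and y: "y \<in> adj_domain D A"
  shows "cinner (control_operator T D A B f) (adj D A y) = \<i> * cinner (control_operator T D A B f') y"
proof -
  note f_L2 = H10_derivativeD(1)[OF f] and f'_L2 = H10_derivativeD(2)[OF f]
  obtain u where u: "weak_solution T D A (\<lambda>t. B (f' t)) u"
    using well_posed_solution[OF wp f'_L2] .
  have u_cont: "continuous_on {0..T} u"
    using u by (simp add: weak_solution_def)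
  define U where "U t = integral {0..t} u" for t
  have U: "(u has_integral U t) {0..t}" if "t \<in> {0..T}" for t
    unfolding U_def using that
    by (intro integrable_integral integrable_continuous_real continuous_on_subset[OF u_cont]) auto
  have BL: "bounded_linear (\<lambda>x. cinner (B x) z)" for z
    using bounded_linear_compose[OF bounded_linear_cinner_left, of B] B
    unfolding bounded_clinear_def by blast
  \<comment> \<open>The weak equation of \<open>u\<close> with its integral evaluated. Keeping the
    integral of \<open>f'\<close> as a free \<open>x\<close> serves two uses: \<open>x = f t\<close>
    for almost every \<open>t\<close>, and \<open>x = 0\<close> at \<open>t = T\<close>.\<close>
  have u_eq: "cinner (U t) (adj D A z) + cinner (B x) z = \<i> * cinner (u t) z"
    if z: "z \<in> adj_domain D A" and t: "t \<in> {0..T}" and x: "(f' has_integral x) {0..t}" for z t x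
  proof -
    have "((\<lambda>s. cinner (u s) (adj D A z) + cinner (B (f' s)) z) has_integral \<i> * cinner (u t) z) {0..t}"
      using u z t unfolding weak_solution_def by blast
    moreover have "((\<lambda>s. cinner (u s) (adj D A z) + cinner (B (f' s)) z) has_integral
        cinner (U t) (adj D A z) + cinner (B x) z) {0..t}"
      using has_integral_linear[OF U[OF t] bounded_linear_cinner_left]
        has_integral_linear[OF x BL] by (intro has_integral_add) (simp_all add: o_def)
    ultimately show ?thesis
      by (rule has_integral_unique[symmetric])
  qed
  obtain N where N: "negligible N" "\<And>t. t \<in> {0..T} - N \<Longrightarrow> (f' has_integral f t) {0..t}"
    using AE_lebesgue_on_negligible[OF H10_derivativeD(3)[OF f]] by blast
  have "weak_solution T D A (\<lambda>t. B (f t)) U"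
    unfolding weak_solution_def
  proof (intro conjI ballI)
    show "continuous_on {0..T} U"
      unfolding U_def by (rule indefinite_integral_continuous_1[OF integrable_continuous_real[OF u_cont]])
    show "U 0 = 0"
      by (simp add: U_def)
    fix z t assume z: "z \<in> adj_domain D A" and t: "t \<in> {0..T}"
    \<comment> \<open>By \<open>u_eq\<close> with \<open>x = f s\<close>, this integrand agrees
      outside the null set \<open>N\<close> with the one in the weak equation for
      \<open>U\<close>.\<close>
    have "((\<lambda>s. \<i> * cinner (u s) z) has_integral \<i> * cinner (U t) z) {0..t}"
      using has_integral_mult_right[OF has_integral_linear[OF U[OF t] bounded_linear_cinner_left, of z], of \<i>]
      by (simp add: o_def)
    then show "((\<lambda>s. cinner (U s) (adj D A z) + cinner (B (f s)) z) has_integral \<i> * cinner (U t) z) {0..t}"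
      by (rule has_integral_spike[OF N(1), rotated]) (use t u_eq[OF z] N(2) in auto)
  qed
  then have "control_operator T D A B f = U T"
    by (rule control_operator_eq[OF T wp f_L2])
  moreover have "control_operator T D A B f' = u T"
    by (rule control_operator_eq[OF T wp f'_L2 u])
  moreover have "B 0 = 0"
    using B by (simp add: bounded_clinear_def bounded_linear.linear linear_0)
  ultimately show ?thesis
    using u_eq[OF y _ H10_derivativeD(4)[OF f]] T by simp
qed

section \<open>The connecting operator\<close>

lemma connecting_operator_L2_space:
  "connecting_operator T W W' C \<Longrightarrow> f \<in> L2_space T \<Longrightarrow> C f \<in> L2_space T"
  unfolding connecting_operator_def by blast

lemma connecting_operator_inner:
  "connecting_operator T W W' C \<Longrightarrow> f \<in> L2_space T \<Longrightarrow> g \<in> L2_space T \<Longrightarrow>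
    L2_inner T (C f) g = cinner (W f) (W' g)"
  unfolding connecting_operator_def by blast

lemma connecting_operator_adjoint:
  assumes C: "connecting_operator T W W' C" and C': "L2_adjoint T C C'"
  shows "connecting_operator T W' W C'"
proof -
  have "L2_inner T (C' g) f = cinner (W' g) (W f)" if "f \<in> L2_space T" "g \<in> L2_space T" for f g
  proof -
    have "L2_inner T (C' g) f = cnj (L2_inner T (C f) g)"
      using C' that L2_inner_commute unfolding L2_adjoint_def by metis
    also have "\<dots> = cinner (W' g) (W f)"
      using connecting_operator_inner[OF C that] cinner_commute by metis
    finally show ?thesis .
  qed
  then show ?thesis
    using C' unfolding connecting_operator_def L2_adjoint_def by blast
qed

text \<open>If the combination vanishes, testing it with every control and totality of the range of
  \<open>W'\<close> give the identity of states. Conversely, the identity makes it orthogonal to all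
  controls, in particular to itself. The combination is formed outside \<open>C\<close>, in the
  three-term shape of the spectral equations.\<close>

lemma connecting_operator_eq_0_iff:
  assumes C: "connecting_operator T W W' C"
    and total: "\<And>x. (\<And>g. g \<in> L2_space T \<Longrightarrow> cinner x (W' g) = 0) \<Longrightarrow> x = 0"
    and f: "f \<in> L2_space T" and g: "g \<in> L2_space T" and h: "h \<in> L2_space T"
  shows "(AE t in lebesgue_on {0<..<T}. C f t + a *\<^sub>C C g t + b *\<^sub>C C h t = 0) \<longleftrightarrow>
    W f + a *\<^sub>C W g + b *\<^sub>C W h = 0"
proof -
  define F where "F t = C f t + a *\<^sub>C C g t + b *\<^sub>C C h t" for t
  have F: "F \<in> L2_space T"
    unfolding F_def by (intro L2_space_add L2_space_scaleC connecting_operator_L2_space[OF C] f g h)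
  have inner: "L2_inner T F k = cinner (W f + a *\<^sub>C W g + b *\<^sub>C W h) (W' k)" if k: "k \<in> L2_space T" for k
    unfolding F_def
    by (simp add: L2_inner_add_left L2_inner_scaleC_left L2_space_add L2_space_scaleC
        connecting_operator_L2_space[OF C] connecting_operator_inner[OF C] f g h k cinner_add_left cinner_scaleC_left)
  show ?thesis
    unfolding F_def[symmetric]
  proof
    assume "AE t in lebesgue_on {0<..<T}. F t = 0"
    then have "L2_inner T F k = 0" for k
      by (rule L2_inner_AE_zero_left)
    then show "W f + a *\<^sub>C W g + b *\<^sub>C W h = 0"
      by (intro total) (simp add: inner[symmetric])
  next
    assume "W f + a *\<^sub>C W g + b *\<^sub>C W h = 0"
    then show "AE t in lebesgue_on {0<..<T}. F t = 0"
      using inner[OF F] by (intro L2_inner_self_eq_0[OF F]) simp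
  qed
qed

section \<open>Chains in a biorthogonal system of root vectors\<close>

text \<open>This is the equation \<open>(A - \<mu>) x = y\<close> for chains, tested with the root vectors \<open>\<psi>\<close> of \<open>A\<^sup>*\<close>.\<close>

definition root_step ::
  "(nat \<Rightarrow> complex) \<Rightarrow> (nat \<Rightarrow> nat) \<Rightarrow> (nat \<Rightarrow> nat \<Rightarrow> 'h::complex_hilbert) \<Rightarrow> complex \<Rightarrow> 'h \<Rightarrow> 'h \<Rightarrow> bool"
  where
  "root_step ev L \<psi> \<mu> x y \<longleftrightarrow>
     (\<forall>r. \<forall>s\<in>{1..L r}. (\<mu> - ev r) * cinner x (\<psi> r s) + cinner y (\<psi> r s) =
        (if s < L r then cinner x (\<psi> r (Suc s)) else 0))"

lemma root_stepD:
  assumes "root_step ev L \<psi> \<mu> x y" and "s \<in> {1..L r}"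
  shows "(\<mu> - ev r) * cinner x (\<psi> r s) + cinner y (\<psi> r s) =
    (if s < L r then cinner x (\<psi> r (Suc s)) else 0)"
  using assms unfolding root_step_def by blast

locale root_system =
  fixes ev :: "nat \<Rightarrow> complex" and L :: "nat \<Rightarrow> nat" and \<phi> \<psi> :: "nat \<Rightarrow> nat \<Rightarrow> 'h::complex_hilbert"
  assumes inj_ev: "inj ev" and L_pos: "1 \<le> L k"
    and biorthogonal: "l \<in> {1..L k} \<Longrightarrow> s \<in> {1..L r} \<Longrightarrow>
      cinner (\<phi> k l) (\<psi> r s) = of_bool (k = r) * of_bool (l = s)"
    and total: "(\<And>r s. s \<in> {1..L r} \<Longrightarrow> cinner x (\<psi> r s) = 0) \<Longrightarrow> x = 0"
begin

lemma eqI: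
  assumes "\<And>r s. s \<in> {1..L r} \<Longrightarrow> cinner x (\<psi> r s) = cinner y (\<psi> r s)"
  shows "x = y"
  using total[of "x - y"] assms by (simp add: cinner_diff_left)

text \<open>\<open>j\<close> may exceed \<open>L k\<close>, where biorthogonality says nothing about
  \<open>\<phi> k l\<close>; hence the condition on \<open>c\<close>.\<close>

lemma cinner_combination:
  assumes s: "s \<in> {1..L r}" and c: "\<And>l. L k < l \<Longrightarrow> l \<le> j \<Longrightarrow> c l = 0"
  shows "cinner (\<Sum>l=1..j. c l *\<^sub>C \<phi> k l) (\<psi> r s) = (if r = k \<and> s \<le> j then c s else 0)"
proof -
  have "cinner (\<Sum>l=1..j. c l *\<^sub>C \<phi> k l) (\<psi> r s) = (\<Sum>l=1..j. if l = s then of_bool (r = k) * c s else 0)"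
    unfolding cinner_sum_left
  proof (rule sum.cong[OF refl])
    fix l assume l: "l \<in> {1..j}"
    show "cinner (c l *\<^sub>C \<phi> k l) (\<psi> r s) = (if l = s then of_bool (r = k) * c s else 0)"
    proof (cases "l \<le> L k")
      case True
      then show ?thesis
        using biorthogonal[of l k s r] l s by (simp add: cinner_scaleC_left)
    next
      case False
      then show ?thesis
        using c[of l] l s by (auto simp: cinner_scaleC_left)
    qed
  qed
  also have "\<dots> = (if r = k \<and> s \<le> j then c s else 0)"
    using s by auto
  finally show ?thesis .
qed

text \<open>Descent in \<open>s\<close>: at \<open>s = L r\<close> the right-hand side is 0 and the
  factor \<open>\<mu> - ev r\<close> cancels; below, the right-hand side is 0 by the previous
  step.\<close>

lemma root_step_off_eigenvalue:
  assumes step: "root_step ev L \<psi> \<mu> x y" and "\<mu> \<noteq> ev r"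
    and y: "\<And>s. s \<in> {1..L r} \<Longrightarrow> cinner y (\<psi> r s) = 0" and s: "s \<in> {1..L r}"
  shows "cinner x (\<psi> r s) = 0"
  using s
proof (induction "L r - s" arbitrary: s)
  case 0
  then show ?case
    using root_stepD[OF step, of s r] y[of s] \<open>\<mu> \<noteq> ev r\<close> by simp
next
  case (Suc n)
  then have "cinner x (\<psi> r (Suc s)) = 0"
    by (intro Suc.hyps(1)) auto
  then show ?case
    using root_stepD[OF step, of s r] y[of s] \<open>\<mu> \<noteq> ev r\<close> Suc.prems by (simp split: if_splits)
qed

text \<open>\<open>\<phi> k 1\<close> pairs only with \<open>\<psi> k 1\<close>, where the factor
  \<open>ev k - ev r\<close> is 0, and never with an index \<open>Suc s\<close>. This is the freedom
  in the coefficient of \<open>\<phi> k 1\<close> at each step.\<close>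

lemma root_step_add_eigenvector:
  assumes "root_step ev L \<psi> (ev k) x y"
  shows "root_step ev L \<psi> (ev k) (x + c *\<^sub>C \<phi> k 1) y"
  unfolding root_step_def
proof (intro allI ballI)
  fix r s assume s: "s \<in> {1..L r}"
  have "(ev k - ev r) * cinner (\<phi> k 1) (\<psi> r s) = 0"
    using biorthogonal[of 1 k s r] L_pos[of k] s by simp
  moreover have "cinner (\<phi> k 1) (\<psi> r (Suc s)) = 0" if "s < L r"
    using biorthogonal[of 1 k "Suc s" r] L_pos[of k] s that by simp
  ultimately show "(ev k - ev r) * cinner (x + c *\<^sub>C \<phi> k 1) (\<psi> r s) + cinner y (\<psi> r s) =
      (if s < L r then cinner (x + c *\<^sub>C \<phi> k 1) (\<psi> r (Suc s)) else 0)"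
    using root_stepD[OF assms s]
    by (cases "s < L r") (auto simp: cinner_add_left cinner_scaleC_left algebra_simps)
qed

text \<open>\<open>A - ev k\<close> lowers the index of \<open>\<phi> k l\<close> by one, which
  takes the \<open>j\<close>-th combination to the one before; for \<open>j = 1\<close> the second
  sum is empty.\<close>

lemma root_step_combination:
  assumes "1 \<le> j" and "j \<le> L k"
  shows "root_step ev L \<psi> (ev k) (\<Sum>l=1..j. \<alpha> (j - l + 1) *\<^sub>C \<phi> k l)
    (\<Sum>l=1..j - 1. \<alpha> (j - 1 - l + 1) *\<^sub>C \<phi> k l)"
  unfolding root_step_def
proof (intro allI ballI)
  fix r s assume s: "s \<in> {1..L r}"
  have c: "cinner (\<Sum>l=1..i. \<alpha> (i - l + 1) *\<^sub>C \<phi> k l) (\<psi> r s) =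
      (if r = k \<and> s \<le> i then \<alpha> (i - s + 1) else 0)" if "i \<le> L k" "s \<in> {1..L r}" for i s
    using that by (intro cinner_combination) auto
  show "(ev k - ev r) * cinner (\<Sum>l=1..j. \<alpha> (j - l + 1) *\<^sub>C \<phi> k l) (\<psi> r s) +
      cinner (\<Sum>l=1..j - 1. \<alpha> (j - 1 - l + 1) *\<^sub>C \<phi> k l) (\<psi> r s) =
      (if s < L r then cinner (\<Sum>l=1..j. \<alpha> (j - l + 1) *\<^sub>C \<phi> k l) (\<psi> r (Suc s)) else 0)"
    using c[of j s] c[of "j - 1" s] c[of j "Suc s"] assms s by (auto simp: Suc_diff_le)
qed

section \<open>Solutions of the chain recurrence, started from the zero vector at index 0\<close>

context
  fixes x :: "nat \<Rightarrow> 'h" and \<mu> :: complex and M :: nat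
  assumes x_0: "x 0 = 0" and steps: "\<And>j. j \<in> {1..M} \<Longrightarrow> root_step ev L \<psi> \<mu> (x j) (x (j - 1))"
begin

lemma root_steps_off_eigenvalue:
  assumes "\<mu> \<noteq> ev r" and s: "s \<in> {1..L r}" and "j \<le> M"
  shows "cinner (x j) (\<psi> r s) = 0"
  using \<open>j \<le> M\<close> s
proof (induction j arbitrary: s)
  case 0
  then show ?case
    by (simp add: x_0)
next
  case (Suc j)
  show ?case
    using root_step_off_eigenvalue[OF steps[of "Suc j"] \<open>\<mu> \<noteq> ev r\<close> _ Suc.prems(2)] Suc by simp
qed

text \<open>At \<open>\<mu> = ev k\<close> a step says that the pairing of \<open>x j\<close> with
  \<open>\<psi> k (Suc s)\<close> is that of \<open>x (j - 1)\<close> with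
  \<open>\<psi> k s\<close>. Going down the diagonal ends at \<open>\<psi> k 1\<close>, or at
  \<open>x 0 = 0\<close> if \<open>j\<close> runs out first.\<close>

lemma root_steps_shift:
  assumes \<mu>: "\<mu> = ev k" and "s \<in> {1..L k}" and "j \<le> M"
  shows "cinner (x j) (\<psi> k s) = (if s \<le> j then cinner (x (j - s + 1)) (\<psi> k 1) else 0)"
  using assms(2,3)
proof (induction s arbitrary: j)
  case (Suc s)
  show ?case
  proof (cases "s = 0 \<or> j = 0")
    case True
    then show ?thesis
      by (cases "j = 0") (auto simp: x_0)
  next
    case False
    then have "cinner (x j) (\<psi> k (Suc s)) = cinner (x (j - 1)) (\<psi> k s)"
      using root_stepD[OF steps[of j], of s k] Suc.prems \<mu> by simp
    also have "\<dots> = (if s \<le> j - 1 then cinner (x (j - 1 - s + 1)) (\<psi> k 1) else 0)"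
      using False Suc.prems by (intro Suc.IH) auto
    finally show ?thesis
      using False by auto
  qed
qed simp

text \<open>The step from \<open>x m\<close> to \<open>x (Suc m)\<close>, tested at the last index
  \<open>L k\<close>, makes that pairing of \<open>x m\<close> vanish, and the shift carries this to
  the first index.\<close>

lemma root_steps_vanish:
  assumes \<mu>: "\<mu> = ev k" and "L k < l" and "l \<le> j" and "j \<le> M"
  shows "cinner (x (j - l + 1)) (\<psi> k 1) = 0"
proof -
  \<comment> \<open>Chosen so that shifting from index \<open>L k\<close> down to 1 lands on
    \<open>x (j - l + 1)\<close>; \<open>L k < l\<close> gives \<open>m < M\<close>, so a next step
    exists.\<close>
  define m where "m = j - l + L k"
  have m: "L k \<le> m" "m < M" "m - L k = j - l"
    using assms by (simp_all add: m_def)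
  have "cinner (x m) (\<psi> k (L k)) = 0"
    using root_stepD[OF steps[of "Suc m"], of "L k" k] m L_pos[of k] \<mu> by simp
  then show ?thesis
    using root_steps_shift[OF \<mu>, of "L k" m] m L_pos[of k] by simp
qed

text \<open>Both sides have the same pairings: at \<open>r = k\<close> by the shift, elsewhere both
  are 0. Terms with \<open>l > L k\<close> have coefficient 0 by
  \<open>root_steps_vanish\<close>.\<close>

lemma root_steps_eq:
  assumes \<mu>: "\<mu> = ev k" and j: "j \<le> M"
  shows "x j = (\<Sum>l=1..j. cinner (x (j - l + 1)) (\<psi> k 1) *\<^sub>C \<phi> k l)"
proof (rule eqI)
  fix r s assume s: "s \<in> {1..L r}"
  have "cinner (\<Sum>l=1..j. cinner (x (j - l + 1)) (\<psi> k 1) *\<^sub>C \<phi> k l) (\<psi> r s) =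
      (if r = k \<and> s \<le> j then cinner (x (j - s + 1)) (\<psi> k 1) else 0)"
    by (intro cinner_combination root_steps_vanish[OF \<mu>] s j)
  also have "\<dots> = cinner (x j) (\<psi> r s)"
  proof (cases "r = k")
    case True
    then show ?thesis
      using root_steps_shift[OF \<mu> _ j, of s] s by simp
  next
    case False
    then have "\<mu> \<noteq> ev r"
      using \<mu> inj_ev by (simp add: inj_eq)
    then show ?thesis
      using root_steps_off_eigenvalue[OF _ s j] False by simp
  qed
  finally show "cinner (x j) (\<psi> r s) =
      cinner (\<Sum>l=1..j. cinner (x (j - l + 1)) (\<psi> k 1) *\<^sub>C \<phi> k l) (\<psi> r s)"
    by simp
qed

end

text \<open>Pairing with \<open>\<psi> r s\<close> is continuous, so it may be applied termwise, and
  biorthogonality leaves a single term.\<close>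

lemma expansion_coefficient:
  assumes sums: "(\<lambda>r. \<Sum>l=1..L r. a r l *\<^sub>C \<phi> r l) sums x" and s: "s \<in> {1..L r}"
  shows "a r s = cinner x (\<psi> r s)"
proof -
  have "(\<lambda>q. cinner (\<Sum>l=1..L q. a q l *\<^sub>C \<phi> q l) (\<psi> r s)) sums cinner x (\<psi> r s)"
    by (rule bounded_linear.sums[OF bounded_linear_cinner_left sums])
  moreover have "cinner (\<Sum>l=1..L q. a q l *\<^sub>C \<phi> q l) (\<psi> r s) = (if q = r then a r s else 0)" for q
    using cinner_combination[OF s, of q "L q" "a q"] s by auto
  ultimately show ?thesis
    using sums_unique2[OF sums_single[of r "\<lambda>_. a r s"]] by simp
qed

lemma expansion_eigenvector:
  "(\<lambda>r. \<Sum>l=1..L r. (if r = k \<and> l = 1 then c else 0) *\<^sub>C \<phi> r l) sums (c *\<^sub>C \<phi> k 1)"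
proof -
  have "(\<Sum>l=1..L r. (if r = k \<and> l = 1 then c else 0) *\<^sub>C \<phi> r l) = (if r = k then c *\<^sub>C \<phi> k 1 else 0)" for r
  proof (rule eqI)
    fix q s assume s: "s \<in> {1..L q}"
    show "cinner (\<Sum>l=1..L r. (if r = k \<and> l = 1 then c else 0) *\<^sub>C \<phi> r l) (\<psi> q s) =
        cinner (if r = k then c *\<^sub>C \<phi> k 1 else 0) (\<psi> q s)"
      using cinner_combination[OF s, of r "L r" "\<lambda>l. if r = k \<and> l = 1 then c else 0"]
        biorthogonal[of 1 k s q] L_pos[of k] s by (auto simp: cinner_scaleC_left)
  qed
  then show ?thesis
    using sums_single[of k "\<lambda>_. c *\<^sub>C \<phi> k 1"] by simp
qed

end

section \<open>The spectral problem for a controlled root system\<close>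

text \<open>The scale \<open>\<sigma>\<close> is \<open>\<i>\<close> for the original system and \<open>- \<i>\<close> for the adjoint one.\<close>

definition scaled_spectral_chain ::
  "real \<Rightarrow> ((real \<Rightarrow> 'y::complex_hilbert) \<Rightarrow> (real \<Rightarrow> 'y)) \<Rightarrow> complex \<Rightarrow> complex \<Rightarrow> nat \<Rightarrow>
   (nat \<Rightarrow> real \<Rightarrow> 'y) \<Rightarrow> bool" where
  "scaled_spectral_chain T C \<sigma> \<mu> M f \<longleftrightarrow>
     1 \<le> M \<and> (\<forall>j\<in>{1..M}. f j \<in> H10_space T) \<and>
     (AE t in lebesgue_on {0<..<T}. C (ddt T (f 1)) t + (\<sigma> * \<mu>) *\<^sub>C C (f 1) t = 0) \<and>
     (\<forall>j\<in>{2..M}. AE t in lebesgue_on {0<..<T}.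
        C (ddt T (f j)) t + (\<sigma> * \<mu>) *\<^sub>C C (f j) t = - (\<sigma> *\<^sub>C C (f (j - 1)) t))"

lemma spectral_chain_iff: "spectral_chain T C \<mu> M f \<longleftrightarrow> scaled_spectral_chain T C \<i> \<mu> M f"
  unfolding spectral_chain_def scaled_spectral_chain_def ..

text \<open>The adjoint chain descends from \<open>N\<close> to 1. Under
  \<open>j \<mapsto> N + 1 - j\<close> it ascends from 1 like the original one, and the scale
  \<open>- \<i>\<close> absorbs the sign changes.\<close>

lemma adjoint_spectral_chain_iff:
  "adjoint_spectral_chain T C \<mu> N g \<longleftrightarrow>
     scaled_spectral_chain T C (- \<i>) (cnj \<mu>) N (\<lambda>j. g (N + 1 - j))"
proof -
  define P where "P l \<longleftrightarrow> (AE t in lebesgue_on {0<..<T}.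
    C (ddt T (g l)) t - (\<i> * cnj \<mu>) *\<^sub>C C (g l) t = \<i> *\<^sub>C C (g (Suc l)) t)" for l
  have sign: "x + (- \<i> * cnj \<mu>) *\<^sub>C y = x - (\<i> * cnj \<mu>) *\<^sub>C y" "- ((- \<i>) *\<^sub>C z) = \<i> *\<^sub>C z" for x y z :: 'a
    by (simp_all add: complex_vs.scale_minus_left)
  have "(\<forall>j\<in>{2..N}. AE t in lebesgue_on {0<..<T}. C (ddt T (g (N + 1 - j))) t +
        (- \<i> * cnj \<mu>) *\<^sub>C C (g (N + 1 - j)) t = - ((- \<i>) *\<^sub>C C (g (N + 1 - (j - 1))) t)) \<longleftrightarrow>
      (\<forall>j\<in>{2..N}. P (N + 1 - j))"
  proof (intro ball_cong refl)
    fix j assume "j \<in> {2..N}"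
    then have "N + 1 - (j - 1) = Suc (N + 1 - j)"
      by auto
    then show "(AE t in lebesgue_on {0<..<T}. C (ddt T (g (N + 1 - j))) t +
        (- \<i> * cnj \<mu>) *\<^sub>C C (g (N + 1 - j)) t = - ((- \<i>) *\<^sub>C C (g (N + 1 - (j - 1))) t)) \<longleftrightarrow>
      P (N + 1 - j)"
      unfolding P_def sign by simp
  qed
  also have "\<dots> \<longleftrightarrow> (\<forall>l\<in>(\<lambda>j. N + 1 - j) ` {2..N}. P l)"
    by blast
  also have "(\<lambda>j. N + 1 - j) ` {2..N} = {1..<N}"
  proof (intro equalityI subsetI)
    fix l assume "l \<in> {1..<N}"
    then show "l \<in> (\<lambda>j. N + 1 - j) ` {2..N}"
      by (intro image_eqI[of _ _ "N + 1 - l"]) auto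
  qed auto
  finally have steps: "(\<forall>j\<in>{2..N}. AE t in lebesgue_on {0<..<T}. C (ddt T (g (N + 1 - j))) t +
        (- \<i> * cnj \<mu>) *\<^sub>C C (g (N + 1 - j)) t = - ((- \<i>) *\<^sub>C C (g (N + 1 - (j - 1))) t)) \<longleftrightarrow>
      (\<forall>l\<in>{1..<N}. P l)" .
  have "(\<forall>j\<in>{1..N}. g (N + 1 - j) \<in> H10_space T) \<longleftrightarrow>
      (\<forall>l\<in>(\<lambda>j. N + 1 - j) ` {1..N}. g l \<in> H10_space T)"
    by blast
  also have "(\<lambda>j. N + 1 - j) ` {1..N} = {1..N}"
  proof (intro equalityI subsetI)
    fix l assume "l \<in> {1..N}"
    then show "l \<in> (\<lambda>j. N + 1 - j) ` {1..N}"
      by (intro image_eqI[of _ _ "N + 1 - l"]) auto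
  qed auto
  finally have H10: "(\<forall>j\<in>{1..N}. g (N + 1 - j) \<in> H10_space T) \<longleftrightarrow> (\<forall>l\<in>{1..N}. g l \<in> H10_space T)" .
  show ?thesis
    unfolding adjoint_spectral_chain_def scaled_spectral_chain_def steps H10
    unfolding P_def sign by simp
qed

text \<open>Collects what the two systems share, so that each is treated by interpretation.
  \<open>W_ddt\<close> is the evolution equation at time \<open>T\<close>, tested with a root
  vector; \<open>C_eq_0_iff\<close> transfers equations between controls and states.\<close>

locale controlled_root_system = root_system ev L \<phi> \<psi>
  for ev :: "nat \<Rightarrow> complex" and L :: "nat \<Rightarrow> nat" and \<phi> \<psi> :: "nat \<Rightarrow> nat \<Rightarrow> 'h::complex_hilbert" +
  fixes T :: real and W :: "(real \<Rightarrow> 'y::complex_hilbert) \<Rightarrow> 'h"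
    and C :: "(real \<Rightarrow> 'y) \<Rightarrow> (real \<Rightarrow> 'y)" and \<sigma> :: complex
  assumes \<sigma>: "\<sigma> \<noteq> 0"
    and W_add: "f \<in> H10_space T \<Longrightarrow> g \<in> H10_space T \<Longrightarrow> W (\<lambda>t. f t + g t) = W f + W g"
    and W_scaleC: "f \<in> H10_space T \<Longrightarrow> W (\<lambda>t. c *\<^sub>C f t) = c *\<^sub>C W f"
    and W_ddt: "f \<in> H10_space T \<Longrightarrow> s \<in> {1..L r} \<Longrightarrow> cinner (W (ddt T f)) (\<psi> r s) =
      - \<sigma> * (ev r * cinner (W f) (\<psi> r s) + (if s < L r then cinner (W f) (\<psi> r (Suc s)) else 0))"
    and C_eq_0_iff: "f \<in> L2_space T \<Longrightarrow> g \<in> L2_space T \<Longrightarrow> h \<in> L2_space T \<Longrightarrow>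
      (AE t in lebesgue_on {0<..<T}. C f t + a *\<^sub>C C g t + b *\<^sub>C C h t = 0) \<longleftrightarrow>
      W f + a *\<^sub>C W g + b *\<^sub>C W h = 0"
    and reach: "l \<in> {1..L k} \<Longrightarrow> \<exists>f\<in>H10_space T. W f = \<phi> k l"
begin

text \<open>By \<open>W_ddt\<close>, each pairing of the left-hand vector is \<open>\<sigma>\<close>
  times the defect in \<open>root_step\<close>; \<open>\<sigma> \<noteq> 0\<close> gives one
  direction, totality the other.\<close>

lemma root_step_W_iff:
  assumes f: "f \<in> H10_space T"
  shows "W (ddt T f) + (\<sigma> * \<mu>) *\<^sub>C W f + \<sigma> *\<^sub>C y = 0 \<longleftrightarrow> root_step ev L \<psi> \<mu> (W f) y"
proof -
  have coeff: "cinner (W (ddt T f) + (\<sigma> * \<mu>) *\<^sub>C W f + \<sigma> *\<^sub>C y) (\<psi> r s) =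
      \<sigma> * ((\<mu> - ev r) * cinner (W f) (\<psi> r s) + cinner y (\<psi> r s) -
        (if s < L r then cinner (W f) (\<psi> r (Suc s)) else 0))" if "s \<in> {1..L r}" for r s
    unfolding cinner_add_left cinner_scaleC_left W_ddt[OF f that]
    by (cases "s < L r") (simp_all add: algebra_simps)
  show ?thesis
  proof
    assume "W (ddt T f) + (\<sigma> * \<mu>) *\<^sub>C W f + \<sigma> *\<^sub>C y = 0"
    then show "root_step ev L \<psi> \<mu> (W f) y"
      unfolding root_step_def using coeff \<sigma> by simp
  next
    assume step: "root_step ev L \<psi> \<mu> (W f) y"
    show "W (ddt T f) + (\<sigma> * \<mu>) *\<^sub>C W f + \<sigma> *\<^sub>C y = 0"
    proof (rule total)
      fix r s assume s: "s \<in> {1..L r}"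
      show "cinner (W (ddt T f) + (\<sigma> * \<mu>) *\<^sub>C W f + \<sigma> *\<^sub>C y) (\<psi> r s) = 0"
        unfolding coeff[OF s] root_stepD[OF step s] by simp
    qed
  qed
qed

abbreviation "chain \<equiv> scaled_spectral_chain T C \<sigma>"

lemma chain_iff:
  "chain \<mu> M f \<longleftrightarrow> 1 \<le> M \<and> (\<forall>j\<in>{1..M}. f j \<in> H10_space T \<and>
     root_step ev L \<psi> \<mu> (W (f j)) (if j = 1 then 0 else W (f (j - 1))))"
proof -
  \<comment> \<open>The first equation has no right-hand side: the third slot of the three-term
    criterion is filled with \<open>h\<close> and coefficient 0.\<close>
  have first: "(AE t in lebesgue_on {0<..<T}. C (ddt T h) t + (\<sigma> * \<mu>) *\<^sub>C C h t = 0) \<longleftrightarrow>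
      root_step ev L \<psi> \<mu> (W h) 0" if "h \<in> H10_space T" for h
    using C_eq_0_iff[of "ddt T h" h h "\<sigma> * \<mu>" 0] root_step_W_iff[OF that, of \<mu> 0] that
    by (simp add: H10_space_L2_space)
  have next_step: "(AE t in lebesgue_on {0<..<T}. C (ddt T h) t + (\<sigma> * \<mu>) *\<^sub>C C h t = - (\<sigma> *\<^sub>C C g t)) \<longleftrightarrow>
      root_step ev L \<psi> \<mu> (W h) (W g)" if "h \<in> H10_space T" "g \<in> H10_space T" for h g
    using C_eq_0_iff[of "ddt T h" h g "\<sigma> * \<mu>" \<sigma>] root_step_W_iff[OF that(1), of \<mu> "W g"] that
    by (simp add: H10_space_L2_space eq_neg_iff_add_eq_0)
  show ?thesis
  proof (cases "1 \<le> M \<and> (\<forall>j\<in>{1..M}. f j \<in> H10_space T)")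
    case True
    then have split: "{1..M} = insert 1 {2..M}"
      by auto
    have pred: "j \<in> {1..M} \<and> j - 1 \<in> {1..M}" if "j \<in> {2..M}" for j
      using that by auto
    have f: "f 1 \<in> H10_space T" "j \<in> {2..M} \<Longrightarrow> f j \<in> H10_space T \<and> f (j - 1) \<in> H10_space T" for j
      using True pred by auto
    have "(\<forall>j\<in>{2..M}. AE t in lebesgue_on {0<..<T}.
        C (ddt T (f j)) t + (\<sigma> * \<mu>) *\<^sub>C C (f j) t = - (\<sigma> *\<^sub>C C (f (j - 1)) t)) \<longleftrightarrow>
      (\<forall>j\<in>{2..M}. root_step ev L \<psi> \<mu> (W (f j)) (W (f (j - 1))))"
      using next_step f(2) by (intro ball_cong refl) blast
    then have "chain \<mu> M f \<longleftrightarrow> root_step ev L \<psi> \<mu> (W (f 1)) 0 \<and>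
        (\<forall>j\<in>{2..M}. root_step ev L \<psi> \<mu> (W (f j)) (W (f (j - 1))))"
      unfolding scaled_spectral_chain_def first[OF f(1)] using True by blast
    moreover have "(\<forall>j\<in>{1..M}. f j \<in> H10_space T \<and>
        root_step ev L \<psi> \<mu> (W (f j)) (if j = 1 then 0 else W (f (j - 1)))) \<longleftrightarrow>
      root_step ev L \<psi> \<mu> (W (f 1)) 0 \<and> (\<forall>j\<in>{2..M}. root_step ev L \<psi> \<mu> (W (f j)) (W (f (j - 1))))"
      unfolding split using f by auto
    ultimately show ?thesis
      using True by blast
  next
    case False
    then show ?thesis
      unfolding scaled_spectral_chain_def by blast
  qed
qed

text \<open>\<open>f 0\<close> is unconstrained, so the states are extended by 0 at index 0; the
  first equation then becomes an ordinary step.\<close>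

lemma chain_steps:
  assumes "chain \<mu> M f"
  defines "x \<equiv> \<lambda>j. if j = 0 then 0 else W (f j)"
  shows "x 0 = 0" and "j \<in> {1..M} \<Longrightarrow> root_step ev L \<psi> \<mu> (x j) (x (j - 1))"
  using assms(1) unfolding chain_iff x_def by (auto split: if_splits)

lemma chain_off_eigenvalue:
  assumes "chain \<mu> M f" and "\<mu> \<noteq> ev r" and "s \<in> {1..L r}" and "j \<in> {1..M}"
  shows "cinner (W (f j)) (\<psi> r s) = 0"
  using root_steps_off_eigenvalue[OF chain_steps[OF assms(1)] assms(2,3), of M j] assms(4) by simp

lemma chain_eq:
  assumes "chain (ev k) M f" and j: "j \<in> {1..M}"
  shows "W (f j) = (\<Sum>l=1..j. cinner (W (f (j - l + 1))) (\<psi> k 1) *\<^sub>C \<phi> k l)"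
  using root_steps_eq[OF chain_steps[OF assms(1)] refl, of M j] j by simp

lemma reach_combination:
  assumes "j \<le> L k"
  shows "\<exists>f\<in>H10_space T. W f = (\<Sum>l=1..j. c l *\<^sub>C \<phi> k l)"
  using assms
proof (induction j)
  case 0
  \<comment> \<open>A zero control, with zero state, is obtained by scaling any reachable control by
    0.\<close>
  obtain f :: "real \<Rightarrow> 'y" where "f \<in> H10_space T"
    using reach[of 1 k] L_pos[of k] by auto
  then show ?case
    using H10_space_scaleC[of f T 0] W_scaleC[of f 0] by auto
next
  case (Suc j)
  then obtain f g where "f \<in> H10_space T" "W f = (\<Sum>l=1..j. c l *\<^sub>C \<phi> k l)"
    and "g \<in> H10_space T" "W g = \<phi> k (Suc j)"
    using reach[of "Suc j" k] by auto
  then show ?case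
    using H10_space_add[of f T "\<lambda>t. c (Suc j) *\<^sub>C g t"] H10_space_scaleC[of g T]
      W_add[of f "\<lambda>t. c (Suc j) *\<^sub>C g t"] W_scaleC[of g] by auto
qed

text \<open>By \<open>chain_iff\<close> the equations see only the states \<open>W (f j)\<close>, so
  the controls can be chosen independently for each \<open>j\<close>.\<close>

lemma chain_exists:
  "\<exists>f. chain (ev k) (L k) f \<and> (\<forall>j\<in>{1..L k}. W (f j) = (\<Sum>l=1..j. \<alpha> (j - l + 1) *\<^sub>C \<phi> k l))"
proof -
  have "\<forall>j\<in>{..L k}. \<exists>f. f \<in> H10_space T \<and> W f = (\<Sum>l=1..j. \<alpha> (j - l + 1) *\<^sub>C \<phi> k l)"
    using reach_combination[of _ k] by (auto simp: Bex_def)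
  from bchoice[OF this] obtain f where f: "\<And>j. j \<le> L k \<Longrightarrow> f j \<in> H10_space T"
    "\<And>j. j \<le> L k \<Longrightarrow> W (f j) = (\<Sum>l=1..j. \<alpha> (j - l + 1) *\<^sub>C \<phi> k l)"
    by auto
  have "root_step ev L \<psi> (ev k) (W (f j)) (if j = 1 then 0 else W (f (j - 1)))" if j: "j \<in> {1..L k}" for j
  proof -
    have "(if j = 1 then 0 else W (f (j - 1))) = (\<Sum>l=1..j - 1. \<alpha> (j - 1 - l + 1) *\<^sub>C \<phi> k l)"
      using f(2)[of "j - 1"] j by auto
    then show ?thesis
      using root_step_combination[of j k \<alpha>] f(2)[of j] j by simp
  qed
  then have "chain (ev k) (L k) f"
    unfolding chain_iff using f(1) L_pos by auto
  then show ?thesis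
    using f(2) by auto
qed

text \<open>A multiple of a control to \<open>\<phi> k 1\<close> is added to \<open>f j\<close>,
  correcting its coefficient to \<open>c\<close> without disturbing step \<open>j\<close>. The chain
  is cut at \<open>j\<close> because a later step would see the new entry; the terms with
  \<open>l \<ge> 2\<close> use only earlier entries.\<close>

lemma chain_last_arbitrary:
  assumes f: "chain (ev k) M f" and j: "j \<in> {1..M}"
  shows "\<exists>h. chain (ev k) j (f(j := h)) \<and>
    W h = c *\<^sub>C \<phi> k 1 + (\<Sum>l=2..j. cinner (W (f (j - l + 1))) (\<psi> k 1) *\<^sub>C \<phi> k l)"
proof -
  define b where "b = cinner (W (f j)) (\<psi> k 1)"
  obtain p where p: "p \<in> H10_space T" "W p = \<phi> k 1"
    using reach[of 1 k] L_pos[of k] by auto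
  define h where "h t = f j t + (c - b) *\<^sub>C p t" for t
  have fj: "f j \<in> H10_space T"
    using f j unfolding chain_iff by blast
  have h: "h \<in> H10_space T" and Wh: "W h = W (f j) + (c - b) *\<^sub>C \<phi> k 1"
    unfolding h_def using fj p by (simp_all add: H10_space_add H10_space_scaleC W_add W_scaleC)
  have "root_step ev L \<psi> (ev k) (W h) (if j = 1 then 0 else W (f (j - 1)))"
    unfolding Wh using f j unfolding chain_iff by (intro root_step_add_eigenvector) auto
  then have "(f(j := h)) i \<in> H10_space T \<and> root_step ev L \<psi> (ev k) (W ((f(j := h)) i))
      (if i = 1 then 0 else W ((f(j := h)) (i - 1)))" if "i \<in> {1..j}" for i
  proof (cases "i = j")
    case True
    then show ?thesis
      using h \<open>root_step ev L \<psi> (ev k) (W h) (if j = 1 then 0 else W (f (j - 1)))\<close> j by auto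
  next
    case False
    then have "i \<in> {1..M}" and upd: "(f(j := h)) i = f i" "(f(j := h)) (i - 1) = f (i - 1)"
      using that j by auto
    then show ?thesis
      unfolding upd using f unfolding chain_iff by blast
  qed
  then have "chain (ev k) j (f(j := h))"
    using j unfolding chain_iff by auto
  moreover have "W (f j) = b *\<^sub>C \<phi> k 1 + (\<Sum>l=2..j. cinner (W (f (j - l + 1))) (\<psi> k 1) *\<^sub>C \<phi> k l)"
    using chain_eq[OF f j] j by (subst (asm) sum.atLeast_Suc_atMost) (auto simp: b_def numeral_2_eq_2)
  then have "W h = c *\<^sub>C \<phi> k 1 + (\<Sum>l=2..j. cinner (W (f (j - l + 1))) (\<psi> k 1) *\<^sub>C \<phi> k l)"
    unfolding Wh by (simp add: complex_vs.scale_left_diff_distrib)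
  ultimately show ?thesis
    by blast
qed

lemma chain_first:
  assumes f: "chain (ev k) M f"
  shows "W (f 1) = cinner (W (f 1)) (\<psi> k 1) *\<^sub>C \<phi> k 1"
  using chain_eq[OF f, of 1] f unfolding chain_iff by simp

text \<open>The parameter is either some \<open>ev k\<close>, giving a series with one nonzero block
  at most, or no eigenvalue, giving the zero state.\<close>

lemma chain_expansion_exists:
  assumes f: "chain \<mu> M f"
  shows "\<exists>a. (\<lambda>r. \<Sum>l=1..L r. a r l *\<^sub>C \<phi> r l) sums W (f 1)"
proof (cases "\<mu> \<in> range ev")
  case True
  then obtain k where "\<mu> = ev k"
    by blast
  then have "W (f 1) = cinner (W (f 1)) (\<psi> k 1) *\<^sub>C \<phi> k 1"
    using chain_first f by simp
  then show ?thesis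
    using expansion_eigenvector[of k "cinner (W (f 1)) (\<psi> k 1)"]
    by (intro exI[of _ "\<lambda>r l. if r = k \<and> l = 1 then cinner (W (f 1)) (\<psi> k 1) else 0"]) simp
next
  case False
  have "1 \<in> {1..M}"
    using f unfolding scaled_spectral_chain_def by simp
  then have "W (f 1) = 0"
    using chain_off_eigenvalue[OF f _ _ \<open>1 \<in> {1..M}\<close>] False by (intro total) auto
  then show ?thesis
    by (intro exI[of _ "\<lambda>r l. 0"]) simp
qed

lemma chain_expansion:
  assumes f: "chain \<mu> M f" and a: "(\<lambda>r. \<Sum>l=1..L r. a r l *\<^sub>C \<phi> r l) sums W (f 1)"
  shows "(\<forall>r. \<mu> \<noteq> ev r \<longrightarrow> (\<forall>l\<in>{1..L r}. a r l = 0)) \<and>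
    (\<forall>k. \<mu> = ev k \<longrightarrow>
       (\<forall>l\<in>{2..L k}. a k l = 0) \<and> W (f 1) = a k 1 *\<^sub>C \<phi> k 1 \<and>
       (\<exists>\<alpha>. \<alpha> 1 = a k 1 \<and>
          (\<forall>j\<in>{2..M}. W (f j) = (\<Sum>l=1..j. \<alpha> (j - l + 1) *\<^sub>C \<phi> k l)) \<and>
          (\<forall>j\<in>{1..M}. \<forall>c. \<exists>h. chain \<mu> j (f(j := h)) \<and>
             W h = c *\<^sub>C \<phi> k 1 + (\<Sum>l=2..j. \<alpha> (j - l + 1) *\<^sub>C \<phi> k l))))"
proof (intro conjI allI impI)
  have M: "1 \<in> {1..M}"
    using f unfolding scaled_spectral_chain_def by simp
  fix r assume "\<mu> \<noteq> ev r"
  then show "\<forall>l\<in>{1..L r}. a r l = 0"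
    using chain_off_eigenvalue[OF f _ _ M] expansion_coefficient[OF a] by simp
next
  fix k assume \<mu>: "\<mu> = ev k"
  have fk: "chain (ev k) M f"
    using f \<mu> by simp
  have a1: "a k 1 = cinner (W (f 1)) (\<psi> k 1)"
    using expansion_coefficient[OF a] L_pos[of k] by simp
  show W1: "W (f 1) = a k 1 *\<^sub>C \<phi> k 1"
    using chain_first[OF fk] a1 by simp
  show "\<forall>l\<in>{2..L k}. a k l = 0"
  proof
    fix l assume l: "l \<in> {2..L k}"
    then have "a k l = cinner (a k 1 *\<^sub>C \<phi> k 1) (\<psi> k l)"
      using expansion_coefficient[OF a, of l k] W1 by simp
    then show "a k l = 0"
      using l biorthogonal[of 1 k l k] by (simp add: cinner_scaleC_left)
  qed
  show "\<exists>\<alpha>. \<alpha> 1 = a k 1 \<and>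
      (\<forall>j\<in>{2..M}. W (f j) = (\<Sum>l=1..j. \<alpha> (j - l + 1) *\<^sub>C \<phi> k l)) \<and>
      (\<forall>j\<in>{1..M}. \<forall>c. \<exists>h. chain \<mu> j (f(j := h)) \<and>
         W h = c *\<^sub>C \<phi> k 1 + (\<Sum>l=2..j. \<alpha> (j - l + 1) *\<^sub>C \<phi> k l))"
    unfolding \<mu> using a1 chain_eq[OF fk] chain_last_arbitrary[OF fk]
    \<comment> \<open>The witness \<open>\<alpha> m\<close> is the coefficient of
      \<open>\<phi> k 1\<close> in \<open>W (f m)\<close>; one sequence serves all
      \<open>j\<close>.\<close>
    by (intro exI[of _ "\<lambda>m. cinner (W (f m)) (\<psi> k 1)"]) auto
qed

end

section \<open>The adjoint system\<close>

lemma adj_eq: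
  assumes total: "\<And>w. (\<And>x. x \<in> D \<Longrightarrow> cinner x w = 0) \<Longrightarrow> w = 0"
    and z: "\<And>x. x \<in> D \<Longrightarrow> cinner (A x) y = cinner x z"
  shows "adj D A y = z"
  unfolding adj_def
proof (rule the_equality)
  fix w assume "\<forall>x\<in>D. cinner (A x) y = cinner x w"
  then have "w - z = 0"
    using z by (intro total) (simp add: cinner_diff_right)
  then show "w = z"
    by simp
qed (use z in blast)

lemma adj_inner:
  assumes total: "\<And>w. (\<And>x. x \<in> D \<Longrightarrow> cinner x w = 0) \<Longrightarrow> w = 0"
    and "y \<in> adj_domain D A" and "x \<in> D"
  shows "cinner (A x) y = cinner x (adj D A y)"
proof -
  obtain z where z: "\<And>x. x \<in> D \<Longrightarrow> cinner (A x) y = cinner x z"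
    using assms(2) unfolding adj_domain_def by blast
  then show ?thesis
    using adj_eq[OF total z] \<open>x \<in> D\<close> by simp
qed

text \<open>The defining identity of the adjoint, read backwards. The weak form of the adjoint
  system tests with the adjoint of its own generator, and this identifies that operator on
  \<open>D\<close>, where the root vectors \<open>\<phi> k l\<close> lie.\<close>

lemma adj_uminus_adj:
  assumes D: "\<And>w. (\<And>x. x \<in> D \<Longrightarrow> cinner x w = 0) \<Longrightarrow> w = 0"
    and D': "\<And>w. (\<And>x. x \<in> adj_domain D A \<Longrightarrow> cinner x w = 0) \<Longrightarrow> w = 0"
    and y: "y \<in> D"
  shows "y \<in> adj_domain (adj_domain D A) (\<lambda>x. - adj D A x)"
    and "adj (adj_domain D A) (\<lambda>x. - adj D A x) y = - A y"
proof -
  have *: "cinner (- adj D A x) y = cinner x (- A y)" if "x \<in> adj_domain D A" for x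
  proof -
    have "cinner x (A y) = cinner (adj D A x) y"
      using adj_inner[OF D that y] by (metis cinner_commute)
    then show ?thesis
      by (simp add: cinner_minus_left cinner_minus_right)
  qed
  then show "y \<in> adj_domain (adj_domain D A) (\<lambda>x. - adj D A x)"
    unfolding adj_domain_def[of "adj_domain D A"] by blast
  show "adj (adj_domain D A) (\<lambda>x. - adj D A x) y = - A y"
    by (rule adj_eq[OF D' *])
qed

text \<open>The adjoint system is written as a system with generator minus the adjoint of
  \<open>A\<close> and input \<open>- B\<close>. Existence of the expansion is asserted separately,
  so that the clause about every \<open>a\<close> is not vacuous. "Arbitrary" means that the last
  entry of a truncated chain can be replaced to attain any complex \<open>c\<close>; chains with
  prescribed coefficients are also asserted to exist.\<close>

theorem mainTheorem3:
  fixes D :: "'h::complex_hilbert set" and A :: "'h \<Rightarrow> 'h"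
    and B :: "'y::complex_hilbert \<Rightarrow> 'h" and T :: real
    and W W' :: "(real \<Rightarrow> 'y) \<Rightarrow> 'h" and C C' :: "(real \<Rightarrow> 'y) \<Rightarrow> (real \<Rightarrow> 'y)"
    and ev :: "nat \<Rightarrow> complex" and L :: "nat \<Rightarrow> nat" and \<phi> \<psi> :: "nat \<Rightarrow> nat \<Rightarrow> 'h"
  assumes "T > 0"
    and "densely_defined_operator D A"
    and "bounded_clinear B"
    and "well_posed T D A B"
    and "well_posed T (adj_domain D A) (\<lambda>x. - adj D A x) (\<lambda>y. - B y)"
    and "W = control_operator T D A B"
    and "W' = control_operator T (adj_domain D A) (\<lambda>x. - adj D A x) (\<lambda>y. - B y)"
    and "connecting_operator T W W' C"
    and "L2_adjoint T C C'"
    and "inj ev" and "op_spectrum D A = range ev"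
    and "\<And>k. L k = alg_multiplicity D A (ev k)" and "\<And>k. 1 \<le> L k" and "\<exists>k. 2 \<le> L k"
    and "riesz_basis (SIGMA k:UNIV. {1..L k}) (\<lambda>(k, l). \<phi> k l)"
    and "\<And>k l. l \<in> {1..L k} \<Longrightarrow> \<phi> k l \<in> D"
    and "\<And>k. A (\<phi> k 1) - ev k *\<^sub>C \<phi> k 1 = 0"
    and "\<And>k l. l \<in> {2..L k} \<Longrightarrow> A (\<phi> k l) - ev k *\<^sub>C \<phi> k l = \<phi> k (l - 1)"
    and "op_spectrum (adj_domain D A) (adj D A) = range (\<lambda>k. cnj (ev k))"
    and "riesz_basis (SIGMA k:UNIV. {1..L k}) (\<lambda>(k, l). \<psi> k l)"
    and "\<And>k l. l \<in> {1..L k} \<Longrightarrow> \<psi> k l \<in> adj_domain D A"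
    and "\<And>k. adj D A (\<psi> k (L k)) - cnj (ev k) *\<^sub>C \<psi> k (L k) = 0"
    and "\<And>k l. l \<in> {1..<L k} \<Longrightarrow> adj D A (\<psi> k l) - cnj (ev k) *\<^sub>C \<psi> k l = \<psi> k (l + 1)"
    and "\<And>k l r s. l \<in> {1..L k} \<Longrightarrow> s \<in> {1..L r} \<Longrightarrow>
           cinner (\<phi> k l) (\<psi> r s) = of_bool (k = r) * of_bool (l = s)"
    and "\<And>k l. l \<in> {1..L k} \<Longrightarrow> \<exists>f\<in>H10_space T. W f = \<phi> k l"
    and "\<And>k l. l \<in> {1..L k} \<Longrightarrow> \<exists>g\<in>H10_space T. W' g = \<psi> k l"
  shows
    "(\<forall>\<mu> M f. spectral_chain T C \<mu> M f \<longrightarrow>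
       (\<exists>a. (\<lambda>r. \<Sum>l=1..L r. a r l *\<^sub>C \<phi> r l) sums W (f 1)) \<and>
       (\<forall>a. (\<lambda>r. \<Sum>l=1..L r. a r l *\<^sub>C \<phi> r l) sums W (f 1) \<longrightarrow>
          (\<forall>r. \<mu> \<noteq> ev r \<longrightarrow> (\<forall>l\<in>{1..L r}. a r l = 0)) \<and>
          (\<forall>k. \<mu> = ev k \<longrightarrow>
             (\<forall>l\<in>{2..L k}. a k l = 0) \<and> W (f 1) = a k 1 *\<^sub>C \<phi> k 1 \<and>
             (\<exists>\<alpha>. \<alpha> 1 = a k 1 \<and>
                (\<forall>j\<in>{2..M}. W (f j) = (\<Sum>l=1..j. \<alpha> (j - l + 1) *\<^sub>C \<phi> k l)) \<and>
                (\<forall>j\<in>{1..M}. \<forall>c. \<exists>h. spectral_chain T C \<mu> j (f(j := h)) \<and>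
                   W h = c *\<^sub>C \<phi> k 1 + (\<Sum>l=2..j. \<alpha> (j - l + 1) *\<^sub>C \<phi> k l)))))) \<and>
     (\<forall>k \<alpha>. \<exists>f. spectral_chain T C (ev k) (L k) f \<and>
           (\<forall>j\<in>{1..L k}. W (f j) = (\<Sum>l=1..j. \<alpha> (j - l + 1) *\<^sub>C \<phi> k l))) \<and>
     (\<forall>k g. adjoint_spectral_chain T C' (ev k) (L k) g \<longrightarrow>
           (\<exists>\<beta>. \<forall>l\<in>{1..L k}. W' (g l) = (\<Sum>j=1..L k - l + 1. \<beta> j *\<^sub>C \<psi> k (j + l - 1)))) \<and>
     (\<forall>k \<beta>. \<exists>g. adjoint_spectral_chain T C' (ev k) (L k) g \<and>
           (\<forall>l\<in>{1..L k}. W' (g l) = (\<Sum>j=1..L k - l + 1. \<beta> j *\<^sub>C \<psi> k (j + l - 1))))"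
proof -
  note biorth = assms(24)
  have \<phi>_total: "x = 0" if "\<And>k l. l \<in> {1..L k} \<Longrightarrow> cinner x (\<phi> k l) = 0" for x
    using riesz_basis_total[OF assms(15), of x] that by auto
  have \<psi>_total: "x = 0" if "\<And>k l. l \<in> {1..L k} \<Longrightarrow> cinner x (\<psi> k l) = 0" for x
    using riesz_basis_total[OF assms(20), of x] that by auto
  have D_total: "w = 0" if "\<And>x. x \<in> D \<Longrightarrow> cinner x w = 0" for w
    using \<phi>_total[of w] that assms(16) by (metis cinner_commute complex_cnj_zero)
  have D'_total: "w = 0" if "\<And>x. x \<in> adj_domain D A \<Longrightarrow> cinner x w = 0" for w
    using \<psi>_total[of w] that assms(21) by (metis cinner_commute complex_cnj_zero)
  note B' = bounded_clinear_uminus[OF assms(3)]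

  \<comment> \<open>The original system as a controlled root system\<close>
  interpret S: controlled_root_system ev L \<phi> \<psi> T W C \<i>
  proof
    show "inj ev" by (rule assms(10))
    show "1 \<le> L k" for k by (rule assms(13))
    show "cinner (\<phi> k l) (\<psi> r s) = of_bool (k = r) * of_bool (l = s)"
      if "l \<in> {1..L k}" "s \<in> {1..L r}" for k l r s by (rule biorth[OF that])
    show "x = 0" if "\<And>r s. s \<in> {1..L r} \<Longrightarrow> cinner x (\<psi> r s) = 0" for x by (rule \<psi>_total[OF that])
    show "\<i> \<noteq> 0" by simp
    show "W (\<lambda>t. f t + g t) = W f + W g" if "f \<in> H10_space T" "g \<in> H10_space T" for f g
      unfolding assms(6) by (rule control_operator_add[OF assms(1,4,3)]) (use that in \<open>auto intro: H10_space_L2_space\<close>)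
    show "W (\<lambda>t. c *\<^sub>C f t) = c *\<^sub>C W f" if "f \<in> H10_space T" for f c
      unfolding assms(6) by (rule control_operator_scaleC[OF assms(1,4,3)]) (use that in \<open>auto intro: H10_space_L2_space\<close>)
    show "\<exists>f\<in>H10_space T. W f = \<phi> k l" if "l \<in> {1..L k}" for k l by (rule assms(25)[OF that])
    show "(AE t in lebesgue_on {0<..<T}. C f t + a *\<^sub>C C g t + b *\<^sub>C C h t = 0) \<longleftrightarrow>
        W f + a *\<^sub>C W g + b *\<^sub>C W h = 0"
      if "f \<in> L2_space T" "g \<in> L2_space T" "h \<in> L2_space T" for f g h a b
    proof (rule connecting_operator_eq_0_iff[OF assms(8) _ that])
      fix x assume "\<And>g. g \<in> L2_space T \<Longrightarrow> cinner x (W' g) = 0"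
      then show "x = 0"
        using \<psi>_total[of x] assms(26) H10_space_L2_space(1) by metis
    qed
    show "cinner (W (ddt T f)) (\<psi> r s) =
        - \<i> * (ev r * cinner (W f) (\<psi> r s) + (if s < L r then cinner (W f) (\<psi> r (Suc s)) else 0))"
      if f: "f \<in> H10_space T" and s: "s \<in> {1..L r}" for f r s
    proof -
      have "adj D A (\<psi> r s) = cnj (ev r) *\<^sub>C \<psi> r s + (if s < L r then \<psi> r (Suc s) else 0)"
        using assms(22)[of r] assms(23)[of s r] s by (cases "s = L r") (auto simp: algebra_simps)
      moreover have "cinner (W f) (adj D A (\<psi> r s)) = \<i> * cinner (W (ddt T f)) (\<psi> r s)"
        unfolding assms(6)
        by (rule control_operator_derivative[OF assms(1,4,3) H10_derivative_ddt[OF f] assms(21)[OF s]])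
      ultimately have "\<i> * cinner (W (ddt T f)) (\<psi> r s) =
          ev r * cinner (W f) (\<psi> r s) + (if s < L r then cinner (W f) (\<psi> r (Suc s)) else 0)"
        by (cases "s < L r") (simp_all add: cinner_add_right cinner_scaleC_right)
      then have "- \<i> * (\<i> * cinner (W (ddt T f)) (\<psi> r s)) =
          - \<i> * (ev r * cinner (W f) (\<psi> r s) + (if s < L r then cinner (W f) (\<psi> r (Suc s)) else 0))"
        by (rule arg_cong)
      then show ?thesis
        by (simp flip: mult.assoc)
    qed
  qed

  \<comment> \<open>Reversing the index turns the root vectors of \<open>A\<^sup>*\<close> into a system of the same form.\<close>
  define \<phi>' \<psi>' where "\<phi>' k l = \<psi> k (L k + 1 - l)" and "\<psi>' k l = \<phi> k (L k + 1 - l)" for k l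
  have rev: "L k + 1 - l \<in> {1..L k}" "L k + 1 - (L k + 1 - l) = l" if "l \<in> {1..L k}" for k l
    using that by auto
  interpret S': controlled_root_system "\<lambda>k. cnj (ev k)" L \<phi>' \<psi>' T W' C' "- \<i>"
  proof
    show "inj (\<lambda>k. cnj (ev k))"
      using assms(10) by (simp add: inj_def)
    show "1 \<le> L k" for k by (rule assms(13))
    show "cinner (\<phi>' k l) (\<psi>' r s) = of_bool (k = r) * of_bool (l = s)"
      if "l \<in> {1..L k}" "s \<in> {1..L r}" for k l r s
    proof -
      have "cinner (\<phi>' k l) (\<psi>' r s) = cnj (cinner (\<phi> r (L r + 1 - s)) (\<psi> k (L k + 1 - l)))"
        unfolding \<phi>'_def \<psi>'_def by (rule cinner_commute)
      also have "\<dots> = of_bool (r = k) * of_bool (L r + 1 - s = L k + 1 - l)"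
        using biorth[OF rev(1)[OF that(2)] rev(1)[OF that(1)]] by simp
      also have "\<dots> = of_bool (k = r) * of_bool (l = s)"
        using that by (cases "k = r") auto
      finally show ?thesis .
    qed
    show "x = 0" if "\<And>r s. s \<in> {1..L r} \<Longrightarrow> cinner x (\<psi>' r s) = 0" for x
    proof (rule \<phi>_total)
      fix k l assume "l \<in> {1..L k}"
      then show "cinner x (\<phi> k l) = 0"
        using that[OF rev(1)] rev(2) unfolding \<psi>'_def by metis
    qed
    show "- \<i> \<noteq> 0" by simp
    show "W' (\<lambda>t. f t + g t) = W' f + W' g" if "f \<in> H10_space T" "g \<in> H10_space T" for f g
      unfolding assms(7) by (rule control_operator_add[OF assms(1,5) B']) (use that in \<open>auto intro: H10_space_L2_space\<close>)
    show "W' (\<lambda>t. c *\<^sub>C f t) = c *\<^sub>C W' f" if "f \<in> H10_space T" for f c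
      unfolding assms(7) by (rule control_operator_scaleC[OF assms(1,5) B']) (use that in \<open>auto intro: H10_space_L2_space\<close>)
    show "\<exists>f\<in>H10_space T. W' f = \<phi>' k l" if "l \<in> {1..L k}" for k l
      unfolding \<phi>'_def by (rule assms(26)[OF rev(1)[OF that]])
    show "(AE t in lebesgue_on {0<..<T}. C' f t + a *\<^sub>C C' g t + b *\<^sub>C C' h t = 0) \<longleftrightarrow>
        W' f + a *\<^sub>C W' g + b *\<^sub>C W' h = 0"
      if "f \<in> L2_space T" "g \<in> L2_space T" "h \<in> L2_space T" for f g h a b
    proof (rule connecting_operator_eq_0_iff[OF connecting_operator_adjoint[OF assms(8,9)] _ that])
      fix x assume "\<And>g. g \<in> L2_space T \<Longrightarrow> cinner x (W g) = 0"
      then show "x = 0"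
        using \<phi>_total[of x] assms(25) H10_space_L2_space(1) by metis
    qed
    have i_mult_eq: "a = - (- \<i>) * b" if "\<i> * a = - b" for a b
    proof -
      have "b = - (\<i> * a)"
        using that by simp
      then show ?thesis
        by (simp flip: mult.assoc)
    qed
    show "cinner (W' (ddt T f)) (\<psi>' r s) = - (- \<i>) *
        (cnj (ev r) * cinner (W' f) (\<psi>' r s) + (if s < L r then cinner (W' f) (\<psi>' r (Suc s)) else 0))"
      if f: "f \<in> H10_space T" and s: "s \<in> {1..L r}" for f r s
    proof -
      have m: "\<psi>' r s \<in> D"
        unfolding \<psi>'_def using assms(16) rev(1)[OF s] by blast
      \<comment> \<open>\<open>A\<close> lowers the index of \<open>\<phi>\<close>, hence raises the
        reversed index of \<open>\<psi>'\<close>; \<open>s = L r\<close> is the eigenvector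
        \<open>\<phi> r 1\<close>.\<close>
      have A_eq: "A (\<psi>' r s) = ev r *\<^sub>C \<psi>' r s + (if s < L r then \<psi>' r (Suc s) else 0)"
      proof (cases "s = L r")
        case True
        then show ?thesis
          using assms(17)[of r] by (simp add: \<psi>'_def)
      next
        case False
        then have "L r + 1 - s \<in> {2..L r}" and "L r + 1 - s - 1 = L r + 1 - Suc s" and "s < L r"
          using s by auto
        then show ?thesis
          using assms(18)[of "L r + 1 - s" r] unfolding \<psi>'_def
          by (simp del: atLeastAtMost_iff add: algebra_simps)
      qed
      have "\<psi>' r s \<in> adj_domain (adj_domain D A) (\<lambda>x. - adj D A x)"
        and adj: "adj (adj_domain D A) (\<lambda>x. - adj D A x) (\<psi>' r s) = - A (\<psi>' r s)"
        by (rule adj_uminus_adj[of D A]; fact D_total D'_total m)+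
      from control_operator_derivative[OF assms(1,5) B' H10_derivative_ddt[OF f] this(1)]
      have "cinner (W' f) (- A (\<psi>' r s)) = \<i> * cinner (W' (ddt T f)) (\<psi>' r s)"
        unfolding adj assms(7) .
      with A_eq have "\<i> * cinner (W' (ddt T f)) (\<psi>' r s) = - (cnj (ev r) * cinner (W' f) (\<psi>' r s) +
          (if s < L r then cinner (W' f) (\<psi>' r (Suc s)) else 0))"
        by (cases "s < L r") (simp_all add: cinner_minus_right cinner_diff_right cinner_add_right cinner_scaleC_right)
      then show ?thesis
        by (rule i_mult_eq)
    qed
  qed

  \<comment> \<open>Substituting \<open>m = n + 1 - j\<close> turns \<open>\<phi>' k m\<close> into
    \<open>\<psi> k (L k - n + j)\<close>, and \<open>L k - n = l - 1\<close>.\<close>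
  have rev_sum: "(\<Sum>m=1..n. \<beta> (n - m + 1) *\<^sub>C \<phi>' k m) = (\<Sum>j=1..L k - l + 1. \<beta> j *\<^sub>C \<psi> k (j + l - 1))"
    if "l \<in> {1..L k}" and n: "n = L k + 1 - l" for k l n and \<beta> :: "nat \<Rightarrow> complex"
    by (rule sum.reindex_bij_witness[of _ "\<lambda>j. n + 1 - j" "\<lambda>m. n + 1 - m"])
      (use that in \<open>auto simp: \<phi>'_def intro!: arg_cong2[of _ _ _ _ scaleC] arg_cong[of _ _ \<beta>] arg_cong[of _ _ "\<psi> k"]\<close>)

  have adjoint_eq: "\<exists>\<beta>. \<forall>l\<in>{1..L k}. W' (g l) = (\<Sum>j=1..L k - l + 1. \<beta> j *\<^sub>C \<psi> k (j + l - 1))"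
    if "adjoint_spectral_chain T C' (ev k) (L k) g" for k g
  proof (intro exI ballI)
    fix l assume l: "l \<in> {1..L k}"
    \<comment> \<open>This fixes the witness: \<open>\<beta> j\<close> is the pairing of the
      \<open>j\<close>-th state, counted from the end of the chain, with
      \<open>\<psi>' k 1 = \<phi> k (L k)\<close>. It does not depend on \<open>l\<close>.\<close>
    show "W' (g l) = (\<Sum>j=1..L k - l + 1. cinner (W' (g (L k + 1 - j))) (\<psi>' k 1) *\<^sub>C \<psi> k (j + l - 1))"
      using S'.chain_eq[OF that[unfolded adjoint_spectral_chain_iff] rev(1)[OF l]]
      unfolding rev(2)[OF l] rev_sum[OF l refl, of "\<lambda>m. cinner (W' (g (L k + 1 - m))) (\<psi>' k 1)"] .
  qed

  have adjoint_exists: "\<exists>g. adjoint_spectral_chain T C' (ev k) (L k) g \<and>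
      (\<forall>l\<in>{1..L k}. W' (g l) = (\<Sum>j=1..L k - l + 1. \<beta> j *\<^sub>C \<psi> k (j + l - 1)))" for k \<beta>
  proof -
    obtain f where f: "S'.chain (cnj (ev k)) (L k) f"
      "\<And>j. j \<in> {1..L k} \<Longrightarrow> W' (f j) = (\<Sum>l=1..j. \<beta> (j - l + 1) *\<^sub>C \<phi>' k l)"
      using S'.chain_exists[of k \<beta>] by blast
    define g where "g l = f (L k + 1 - l)" for l
    \<comment> \<open>Truncated subtraction makes double reversal the identity only for small
      indices, so the reversed family is not equal to \<open>f\<close> as a function and its entries
      are checked one by one.\<close>
    have "S'.chain (cnj (ev k)) (L k) (\<lambda>j. g (L k + 1 - j))"
      unfolding S'.chain_iff
    proof (intro conjI ballI)
      show "1 \<le> L k" by (rule assms(13))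
      fix j assume j: "j \<in> {1..L k}"
      have step: "f j \<in> H10_space T \<and> root_step (\<lambda>k. cnj (ev k)) L \<psi>' (cnj (ev k)) (W' (f j))
          (if j = 1 then 0 else W' (f (j - 1)))"
        using f(1) j unfolding S'.chain_iff by blast
      have "g (L k + 1 - j) = f j"
        unfolding g_def rev(2)[OF j] ..
      moreover have "g (L k + 1 - (j - 1)) = f (j - 1)" if "j \<noteq> 1"
        unfolding g_def using that j by (subst rev(2)) auto
      ultimately show "g (L k + 1 - j) \<in> H10_space T"
        and "root_step (\<lambda>k. cnj (ev k)) L \<psi>' (cnj (ev k)) (W' (g (L k + 1 - j)))
          (if j = 1 then 0 else W' (g (L k + 1 - (j - 1))))"
        using step by (auto split: if_splits)
    qed
    then have "adjoint_spectral_chain T C' (ev k) (L k) g"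
      unfolding adjoint_spectral_chain_iff .
    moreover have "W' (g l) = (\<Sum>j=1..L k - l + 1. \<beta> j *\<^sub>C \<psi> k (j + l - 1))" if l: "l \<in> {1..L k}" for l
      unfolding g_def f(2)[OF rev(1)[OF l]] rev_sum[OF l refl] ..
    ultimately show ?thesis
      by blast
  qed

  show ?thesis
    unfolding spectral_chain_iff
    by (rule conjI[OF _ conjI[OF _ conjI]]; (rule allI | rule impI)+)
      (rule conjI, erule S.chain_expansion_exists, (rule allI | rule impI)+, erule S.chain_expansion,
        assumption, rule S.chain_exists, erule adjoint_eq, rule adjoint_exists)
qed

end
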